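(* Let $(B,g_B)$ and $(F,g_F)$ be Riemannian manifolds of dimensions $n_1=\dim B$ and $n_2=\dim F$, let $n=n_1+n_2$, let $f$ be a positive differentiable function on $B$, and let $(B\times_f F,g)$ be the warped product manifold with metric $g=g_B+f^2g_F$. Let $\phi$ be an isometric immersion from $(B\times_f F,g)$ to the Clifford torus $\overline{M}_{m_1,m_2}=S^{m_1}\big(\sqrt{\tfrac{m_1}{m}}\big)\times S^{m_2}\big(\sqrt{\tfrac{m_2}{m}}\big)$ with $2\le m_1\le\frac m2$, $m=m_1+m_2$, and $m\ge4$. Then, at every point, $$\frac{\triangle f}{f}\ge\frac{n_1n^2}{2(n-1)}H^2-\frac{n_1}{2}\|h\|^2.$$
   Context: Manifolds have positive dimension and "differentiable" means smooth. The warped product $M=B\times_f F$ is $B\times F$ with the metric $g$ given by $\|X\|^2=\|d\pi_1X\|^2+f^2(\pi_1(x))\|d\pi_2X\|^2$ for $X\in T_xM$, where $\pi_1:B\times F\to B$ and $\pi_2:B\times F\to F$ are the projections; functions on $B$ are regarded as functions on $M$ via $\pi_1$. $\mathcal{D}_1$ is the distribution on $M$ of vectors tangent to the lifts of $B$. Laplacian: $\triangle f=\sum_{i=1}^{n_1}\big((\nabla_{e_i}e_i)f-e_i^2f\big)$, where $e_1,\dots,e_{n_1}$ is a local orthonormal frame of $\mathcal{D}_1$ consisting of lifts of a local orthonormal frame of $B$ and $\nabla$ is the Levi-Civita connection of $(M,g)$; equivalently, $\triangle f=-\mathrm{div}(\mathrm{grad}\,f)$ computed on $(B,g_B)$ (note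 the sign). With $h$ the second fundamental form of $\phi$ and $e_1,\dots,e_n$ a local orthonormal frame of $TM$: $\overrightarrow{H}=\frac1n\sum_{i=1}^n h(e_i,e_i)$ is the mean curvature vector, $H^2=\langle\overrightarrow{H},\overrightarrow{H}\rangle$, and $\|h\|^2=\sum_{i,j=1}^n\langle h(e_i,e_j),h(e_i,e_j)\rangle$. $S^k(r)$ denotes the $k$-dimensional round sphere of radius $r$ in $\mathbb{R}^{k+1}$ (constant sectional curvature $1/r^2$); the Clifford torus $\overline{M}_{m_1,m_2}\subset S^{m+1}(1)$ carries the Riemannian product metric. *)

theory Defs
  imports "HOL-Analysis.Analysis"
begin

section \<open>Smooth maps between open subsets of Euclidean spaces\<close>

text \<open>\<open>deriv_along X u\<close> is the derivative of \<open>u\<close> in the direction of the vector field \<open>X\<close>; the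
  derivative of \<open>u\<close> at \<open>x\<close> is \<open>frechet_derivative u (at x)\<close>.  All uses are on open sets.\<close>

definition deriv_along ::
  "('a::real_normed_vector \<Rightarrow> 'a) \<Rightarrow> ('a \<Rightarrow> 'b::real_normed_vector) \<Rightarrow> 'a \<Rightarrow> 'b" where
  "deriv_along X u x = frechet_derivative u (at x) (X x)"

fun Ck_on ::
  "nat \<Rightarrow> 'a::real_normed_vector set \<Rightarrow> ('a \<Rightarrow> 'b::real_normed_vector) \<Rightarrow> bool" where
  "Ck_on 0 S u \<longleftrightarrow> continuous_on S u"
| "Ck_on (Suc k) S u \<longleftrightarrow>
     (\<forall>x\<in>S. u differentiable (at x)) \<and> (\<forall>v. Ck_on k S (deriv_along (\<lambda>_. v) u))"

definition smooth_on ::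
  "'a::real_normed_vector set \<Rightarrow> ('a \<Rightarrow> 'b::real_normed_vector) \<Rightarrow> bool" where
  "smooth_on S u \<longleftrightarrow> (\<forall>k. Ck_on k S u)"


section \<open>Riemannian manifolds\<close>

text \<open>A Riemannian manifold modelled on the Euclidean space \<open>'e\<close> (so its dimension is
  \<open>DIM('e)\<close>, which is positive) is given by a topological space, an atlas
  \<open>{(cdom i, cmap i) | i \<in> ind}\<close>, and the metric tensor in each chart:
  \<open>metr i x u v\<close> is the inner product of the tangent vectors at the point with coordinates \<open>x\<close>
  whose components in the chart \<open>i\<close> are \<open>u\<close> and \<open>v\<close>.\<close>

record ('i, 'm, 'e) riem =
  mtop :: "'m topology"
  ind :: "'i set"
  cdom :: "'i \<Rightarrow> 'm set"
  cmap :: "'i \<Rightarrow> 'm \<Rightarrow> 'e"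
  metr :: "'i \<Rightarrow> 'e \<Rightarrow> 'e \<Rightarrow> 'e \<Rightarrow> real"

definition param :: "('i, 'm, 'e) riem \<Rightarrow> 'i \<Rightarrow> 'e \<Rightarrow> 'm" where
  "param M i = inv_into (cdom M i) (cmap M i)"

definition smooth_manifold :: "('i, 'm, 'e::euclidean_space) riem \<Rightarrow> bool" where
  "smooth_manifold M \<longleftrightarrow>
     Hausdorff_space (mtop M) \<and> second_countable (mtop M) \<and>
     (\<Union>i\<in>ind M. cdom M i) = topspace (mtop M) \<and>
     (\<forall>i\<in>ind M. openin (mtop M) (cdom M i) \<and> open (cmap M i ` cdom M i) \<and>
        homeomorphic_map (subtopology (mtop M) (cdom M i))
          (top_of_set (cmap M i ` cdom M i)) (cmap M i)) \<and>
     (\<forall>i\<in>ind M. \<forall>j\<in>ind M.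
        smooth_on (cmap M i ` (cdom M i \<inter> cdom M j)) (cmap M j \<circ> param M i))"

text \<open>The last conjunct is the transformation law of a covariant 2-tensor.\<close>

definition riemannian_manifold :: "('i, 'm, 'e::euclidean_space) riem \<Rightarrow> bool" where
  "riemannian_manifold M \<longleftrightarrow> smooth_manifold M \<and>
     (\<forall>i\<in>ind M. \<forall>x \<in> cmap M i ` cdom M i.
        bilinear (metr M i x) \<and> (\<forall>u v. metr M i x u v = metr M i x v u) \<and>
        (\<forall>u. u \<noteq> 0 \<longrightarrow> metr M i x u u > 0)) \<and>
     (\<forall>i\<in>ind M. \<forall>u v. smooth_on (cmap M i ` cdom M i) (\<lambda>x. metr M i x u v)) \<and>
     (\<forall>i\<in>ind M. \<forall>j\<in>ind M. \<forall>x \<in> cmap M i ` (cdom M i \<inter> cdom M j). \<forall>u v.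
        metr M i x u v =
          metr M j (cmap M j (param M i x))
            (frechet_derivative (cmap M j \<circ> param M i) (at x) u)
            (frechet_derivative (cmap M j \<circ> param M i) (at x) v))"

definition smooth_function :: "('i, 'm, 'e::euclidean_space) riem \<Rightarrow> ('m \<Rightarrow> real) \<Rightarrow> bool" where
  "smooth_function M f \<longleftrightarrow> (\<forall>i\<in>ind M. smooth_on (cmap M i ` cdom M i) (f \<circ> param M i))"


section \<open>Warped products, round spheres and the Clifford torus\<close>

definition warped_product ::
  "('i, 'a, 'b) riem \<Rightarrow> ('a \<Rightarrow> real) \<Rightarrow> ('j, 'c, 'd) riem \<Rightarrow> ('i \<times> 'j, 'a \<times> 'c, 'b \<times> 'd) riem"
where
  "warped_product B f F =
     \<lparr> mtop = prod_topology (mtop B) (mtop F),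
       ind = ind B \<times> ind F,
       cdom = (\<lambda>(i, j). cdom B i \<times> cdom F j),
       cmap = (\<lambda>(i, j) (p, q). (cmap B i p, cmap F j q)),
       metr = (\<lambda>(i, j) (x, y) (u, u') (v, v').
                 metr B i x u v + (f (param B i x))\<^sup>2 * metr F j y u' v') \<rparr>"

definition riem_product ::
  "('i, 'a, 'b) riem \<Rightarrow> ('j, 'c, 'd) riem \<Rightarrow> ('i \<times> 'j, 'a \<times> 'c, 'b \<times> 'd) riem" where
  "riem_product B F = warped_product B (\<lambda>_. 1) F"

text \<open>The sphere of radius \<open>r > 0\<close> and dimension \<open>DIM('s)\<close> about the origin of
  \<open>'s \<times> real\<close>, a Euclidean space of dimension \<open>DIM('s) + 1\<close>, with the two stereographic
  projections from the poles \<open>(0, r)\<close> and \<open>(0, - r)\<close> as charts and the metric induced by the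
  ambient inner product.\<close>

definition stereo_map :: "real \<Rightarrow> real \<Rightarrow> 's::euclidean_space \<times> real \<Rightarrow> 's" where
  "stereo_map r s = (\<lambda>(y, t). (r / (r - s * t)) *\<^sub>R y)"

definition stereo_dom :: "real \<Rightarrow> real \<Rightarrow> ('s::euclidean_space \<times> real) set" where
  "stereo_dom r s = sphere 0 r - {(0, s * r)}"

definition round_sphere :: "real \<Rightarrow> (real, 's::euclidean_space \<times> real, 's) riem" where
  "round_sphere r =
     \<lparr> mtop = top_of_set (sphere 0 r),
       ind = {1, - 1},
       cdom = stereo_dom r,
       cmap = stereo_map r,
       metr = (\<lambda>s x u v.
         frechet_derivative (inv_into (stereo_dom r s) (stereo_map r s)) (at x) u \<bullet>
         frechet_derivative (inv_into (stereo_dom r s) (stereo_map r s)) (at x) v) \<rparr>"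

text \<open>With \<open>m\<^sub>1 = DIM('s)\<close>, \<open>m\<^sub>2 = DIM('t)\<close> and \<open>m = m\<^sub>1 + m\<^sub>2\<close>, the Clifford torus is the
  Riemannian product of spheres of dimensions \<open>m\<^sub>1\<close>, \<open>m\<^sub>2\<close> and radii \<open>sqrt (m\<^sub>1 / m)\<close>,
  \<open>sqrt (m\<^sub>2 / m)\<close>.\<close>

definition clifford_torus ::
  "(real \<times> real, ('s::euclidean_space \<times> real) \<times> ('t::euclidean_space \<times> real), 's \<times> 't) riem"
where
  "clifford_torus =
     riem_product (round_sphere (sqrt (real DIM('s) / real (DIM('s) + DIM('t)))))
                  (round_sphere (sqrt (real DIM('t) / real (DIM('s) + DIM('t)))))"


section \<open>Levi-Civita connection and Laplacian\<close>

text \<open>Vector fields are given by their components in a chart \<open>i\<close>.  \<open>christoffel M i x u v\<close> is the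
  value at \<open>x\<close> of the covariant derivative of the field with constant components \<open>v\<close> in the
  direction \<open>u\<close>.  The connection is characterised by being torsion-free and metric; as constant
  coordinate fields commute, the former amounts to symmetry.\<close>

definition christoffel ::
  "('i, 'm, 'e::euclidean_space) riem \<Rightarrow> 'i \<Rightarrow> 'e \<Rightarrow> 'e \<Rightarrow> 'e \<Rightarrow> 'e" where
  "christoffel M i x = (THE \<Gamma>. bilinear \<Gamma> \<and> (\<forall>u v. \<Gamma> u v = \<Gamma> v u) \<and>
     (\<forall>w u v. deriv_along (\<lambda>_. w) (\<lambda>y. metr M i y u v) x
                = metr M i x (\<Gamma> w u) v + metr M i x u (\<Gamma> w v)))"

definition nabla ::
  "('i, 'm, 'e::euclidean_space) riem \<Rightarrow> 'i \<Rightarrow> ('e \<Rightarrow> 'e) \<Rightarrow> ('e \<Rightarrow> 'e) \<Rightarrow> 'e \<Rightarrow> 'e" where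
  "nabla M i X Y x = deriv_along X Y x + christoffel M i x (X x) (Y x)"

text \<open>A local orthonormal frame \<open>E 0, \<dots>, E (DIM('e) - 1)\<close> around the point \<open>p\<close>, in the chart \<open>i\<close>.\<close>

definition orthonormal_frame ::
  "('i, 'm, 'e::euclidean_space) riem \<Rightarrow> 'i \<Rightarrow> 'm \<Rightarrow> (nat \<Rightarrow> 'e \<Rightarrow> 'e) \<Rightarrow> bool" where
  "orthonormal_frame M i p E \<longleftrightarrow>
     (\<exists>W. open W \<and> cmap M i p \<in> W \<and> W \<subseteq> cmap M i ` cdom M i \<and>
        (\<forall>a<DIM('e). smooth_on W (E a)) \<and>
        (\<forall>x\<in>W. \<forall>a<DIM('e). \<forall>b<DIM('e).
           metr M i x (E a x) (E b x) = (if a = b then 1 else 0)))"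

text \<open>Lift to a product of a vector field on the first factor, in a product chart.\<close>

definition lift_field :: "('b \<Rightarrow> 'b) \<Rightarrow> 'b \<times> 'd \<Rightarrow> 'b \<times> 'd::zero" where
  "lift_field X = (\<lambda>(x, y). (X x, 0))"

text \<open>The Laplacian (with the sign of \<open>- div grad\<close>) of a function \<open>f\<close> on \<open>B\<close>, regarded as a function
  on \<open>B \<times>\<^sub>f F\<close>, at \<open>(p, q)\<close>: the sum over the lifts of an orthonormal frame \<open>E\<close> of \<open>B\<close> of
  \<open>(\<nabla>\<^sub>e e) f - e (e f)\<close>, where \<open>\<nabla>\<close> is the Levi-Civita connection of \<open>B \<times>\<^sub>f F\<close>.\<close>

definition warped_laplacian ::
  "('i, 'a, 'b::euclidean_space) riem \<Rightarrow> ('a \<Rightarrow> real) \<Rightarrow> ('j, 'c, 'd::euclidean_space) riem \<Rightarrow>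
   'i \<times> 'j \<Rightarrow> (nat \<Rightarrow> 'b \<Rightarrow> 'b) \<Rightarrow> 'a \<times> 'c \<Rightarrow> real" where
  "warped_laplacian B f F c E P =
     (let M = warped_product B f F;
          u = (f \<circ> fst) \<circ> param M c;
          e = (\<lambda>a. lift_field (E a)) :: nat \<Rightarrow> 'b \<times> 'd \<Rightarrow> 'b \<times> 'd
      in \<Sum>a<DIM('b). deriv_along (nabla M c (e a) (e a)) u (cmap M c P)
                      - deriv_along (e a) (deriv_along (e a) u) (cmap M c P))"


section \<open>Isometric immersions and their second fundamental form\<close>

definition coord_rep ::
  "('i, 'm, 'e) riem \<Rightarrow> ('k, 'n, 'g) riem \<Rightarrow> ('m \<Rightarrow> 'n) \<Rightarrow> 'i \<Rightarrow> 'k \<Rightarrow> 'e \<Rightarrow> 'g" where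
  "coord_rep M N \<phi> i k = cmap N k \<circ> \<phi> \<circ> param M i"

definition smooth_map ::
  "('i, 'm, 'e::euclidean_space) riem \<Rightarrow> ('k, 'n, 'g::euclidean_space) riem \<Rightarrow> ('m \<Rightarrow> 'n) \<Rightarrow> bool"
where
  "smooth_map M N \<phi> \<longleftrightarrow> continuous_map (mtop M) (mtop N) \<phi> \<and>
     (\<forall>i\<in>ind M. \<forall>k\<in>ind N.
        smooth_on (cmap M i ` (cdom M i \<inter> \<phi> -` cdom N k)) (coord_rep M N \<phi> i k))"

definition isometric_immersion ::
  "('i, 'm, 'e::euclidean_space) riem \<Rightarrow> ('k, 'n, 'g::euclidean_space) riem \<Rightarrow> ('m \<Rightarrow> 'n) \<Rightarrow> bool"
where
  "isometric_immersion M N \<phi> \<longleftrightarrow> smooth_map M N \<phi> \<and>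
     (\<forall>i\<in>ind M. \<forall>k\<in>ind N. \<forall>x \<in> cmap M i ` (cdom M i \<inter> \<phi> -` cdom N k).
        let d\<phi> = frechet_derivative (coord_rep M N \<phi> i k) (at x)
        in inj d\<phi> \<and>
           (\<forall>u v. metr M i x u v = metr N k (coord_rep M N \<phi> i k x) (d\<phi> u) (d\<phi> v)))"

text \<open>Covariant derivative, along \<open>\<phi>\<close> and in the direction of the field \<open>X\<close> on \<open>M\<close>, of a vector
  field \<open>V\<close> along \<open>\<phi>\<close>, with respect to the Levi-Civita connection of \<open>N\<close>.\<close>

definition nabla_along ::
  "('i, 'm, 'e::euclidean_space) riem \<Rightarrow> ('k, 'n, 'g::euclidean_space) riem \<Rightarrow> ('m \<Rightarrow> 'n) \<Rightarrow>
   'i \<Rightarrow> 'k \<Rightarrow> ('e \<Rightarrow> 'e) \<Rightarrow> ('e \<Rightarrow> 'g) \<Rightarrow> 'e \<Rightarrow> 'g" where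
  "nabla_along M N \<phi> i k X V x =
     deriv_along X V x
     + christoffel N k (coord_rep M N \<phi> i k x) (deriv_along X (coord_rep M N \<phi> i k) x) (V x)"

text \<open>The second fundamental form, by the Gauss formula
  \<open>\<nabla>\<^sup>N\<^sub>X d\<phi>(Y) = d\<phi>(\<nabla>\<^sup>M\<^sub>X Y) + h(X, Y)\<close>.  Note that \<open>deriv_along Y \<phi>\<close> is \<open>d\<phi>(Y)\<close>.\<close>

definition second_ff ::
  "('i, 'm, 'e::euclidean_space) riem \<Rightarrow> ('k, 'n, 'g::euclidean_space) riem \<Rightarrow> ('m \<Rightarrow> 'n) \<Rightarrow>
   'i \<Rightarrow> 'k \<Rightarrow> ('e \<Rightarrow> 'e) \<Rightarrow> ('e \<Rightarrow> 'e) \<Rightarrow> 'e \<Rightarrow> 'g" where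
  "second_ff M N \<phi> i k X Y x =
     nabla_along M N \<phi> i k X (deriv_along Y (coord_rep M N \<phi> i k)) x
     - deriv_along (nabla M i X Y) (coord_rep M N \<phi> i k) x"

definition mean_curvature_vector ::
  "('i, 'm, 'e::euclidean_space) riem \<Rightarrow> ('k, 'n, 'g::euclidean_space) riem \<Rightarrow> ('m \<Rightarrow> 'n) \<Rightarrow>
   'i \<Rightarrow> 'k \<Rightarrow> (nat \<Rightarrow> 'e \<Rightarrow> 'e) \<Rightarrow> 'm \<Rightarrow> 'g" where
  "mean_curvature_vector M N \<phi> i k e p =
     (1 / real DIM('e)) *\<^sub>R (\<Sum>a<DIM('e). second_ff M N \<phi> i k (e a) (e a) (cmap M i p))"

definition mean_curvature_sq ::
  "('i, 'm, 'e::euclidean_space) riem \<Rightarrow> ('k, 'n, 'g::euclidean_space) riem \<Rightarrow> ('m \<Rightarrow> 'n) \<Rightarrow>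
   'i \<Rightarrow> 'k \<Rightarrow> (nat \<Rightarrow> 'e \<Rightarrow> 'e) \<Rightarrow> 'm \<Rightarrow> real" where
  "mean_curvature_sq M N \<phi> i k e p =
     metr N k (cmap N k (\<phi> p))
       (mean_curvature_vector M N \<phi> i k e p) (mean_curvature_vector M N \<phi> i k e p)"

definition second_ff_norm_sq ::
  "('i, 'm, 'e::euclidean_space) riem \<Rightarrow> ('k, 'n, 'g::euclidean_space) riem \<Rightarrow> ('m \<Rightarrow> 'n) \<Rightarrow>
   'i \<Rightarrow> 'k \<Rightarrow> (nat \<Rightarrow> 'e \<Rightarrow> 'e) \<Rightarrow> 'm \<Rightarrow> real" where
  "second_ff_norm_sq M N \<phi> i k e p =
     (\<Sum>a<DIM('e). \<Sum>b<DIM('e).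
        metr N k (cmap N k (\<phi> p))
          (second_ff M N \<phi> i k (e a) (e b) (cmap M i p))
          (second_ff M N \<phi> i k (e a) (e b) (cmap M i p)))"

end

theory Submission
  imports Defs
begin

text \<open>
  The torus lies in a Euclidean space \<open>V\<close>, so the immersion becomes an isometric immersion \<open>\<psi>\<close> of
  \<open>B \<times>\<^sub>f F\<close> into \<open>V\<close>.  Differentiating the three identities that express the warped metric by inner
  products of first derivatives of \<open>\<psi>\<close> gives, for \<open>u\<close> tangent to \<open>B\<close> and a unit vector \<open>v\<close> tangent to
  \<open>F\<close>, the Gauss equation
  \<open>(\<nabla>\<^sub>u u f - u u f) / f = \<langle>H(u,u), H(v,v)\<rangle> - \<langle>H(u,v), H(u,v)\<rangle>\<close>,
  where \<open>H\<close> is the second fundamental form of \<open>\<psi>\<close>.  It splits orthogonally into that of \<open>\<phi>\<close> and that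
  of the torus in \<open>V\<close>; by Cauchy-Schwarz on each sphere the torus contributes a nonnegative
  term.  What remains is bounded below by Chen's algebraic inequality, and summing over an orthonormal
  frame \<open>u = E\<^sub>a\<close> of \<open>B\<close> produces the Laplacian.
\<close>

section \<open>Directional derivatives\<close>

text \<open>No curvature tensor is formed. \<open>christoffel\<close> is given only by a definite
  description, so existence and uniqueness have to be proved before it can be used; for a metric
  induced by a map into Euclidean space, \<open>christoffel_immersion\<close> identifies it with the
  tangential part of the second derivative. This serves both the warped product (through \<psi>) and
  the torus (through its inverse chart), and every term becomes an inner product of derivatives at
  one point. The only third derivative, twice along \<open>u\<close> and once along
  \<open>v\<close>, occurs in two differentiated identities and cancels between them; this is why
  three orders of smoothness are tracked.

  The constants: merging two diagonal entries leaves n - 1 summands in Cauchy-Schwarz, hence the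
  denominator 2(n - 1); the factor n^2 turns the mean curvature vector back into the full trace; n1
  counts the vectors of the base frame, each of which is paired with one and the same unit fibre
  vector.\<close>

abbreviation dir :: "'a::real_normed_vector \<Rightarrow> ('a \<Rightarrow> 'b::real_normed_vector) \<Rightarrow> 'a \<Rightarrow> 'b" where
  "dir v u \<equiv> deriv_along (\<lambda>_. v) u"

lemma deriv_along_eq_dir: "deriv_along X u x = dir (X x) u x"
  by (simp add: deriv_along_def)

lemma has_derivative_dir:
  "u differentiable (at x) \<Longrightarrow> (u has_derivative (\<lambda>v. dir v u x)) (at x)"
  by (simp add: deriv_along_def frechet_derivative_works)

lemma dir_eqI: "(u has_derivative u') (at x) \<Longrightarrow> dir v u x = u' v"
  by (metis deriv_along_def frechet_derivative_at)

lemma linear_dir: "u differentiable (at x) \<Longrightarrow> linear (\<lambda>v. dir v u x)"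
  by (simp add: deriv_along_def linear_frechet_derivative)

lemma dir_add: "u differentiable (at x) \<Longrightarrow> dir (v + w) u x = dir v u x + dir w u x"
  by (rule linear_add[OF linear_dir])

lemma dir_scaleR: "u differentiable (at x) \<Longrightarrow> dir (c *\<^sub>R v) u x = c *\<^sub>R dir v u x"
  by (rule linear_cmul[OF linear_dir])

lemma dir_const: "dir v (\<lambda>_. c) x = 0"
  by (simp add: deriv_along_def)

lemma dir_zero: "u differentiable (at x) \<Longrightarrow> dir 0 u x = 0"
  by (rule linear_0[OF linear_dir])

lemma dir_cong:
  assumes "open S" "x \<in> S" "\<And>y. y \<in> S \<Longrightarrow> f y = g y"
  shows "dir v f x = dir v g x"
proof (cases "f differentiable (at x)")
  case True
  then show ?thesis
    using assms by (simp add: deriv_along_def frechet_derivative_transform_within_open)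
next
  case False
  \<comment> \<open>\<open>frechet_derivative\<close> is a choice among all derivatives. Equal sets
    of candidates give equal choices, even when both sets are empty.\<close>
  have "(f has_derivative D) (at x) \<longleftrightarrow> (g has_derivative D) (at x)" for D
    
    using has_derivative_transform_within_open[of f D x UNIV S g]
      has_derivative_transform_within_open[of g D x UNIV S f] assms by auto
  then show ?thesis by (simp add: deriv_along_def frechet_derivative_def)
qed

section \<open>Closure properties of \<open>Ck_on\<close>\<close>

lemma Ck_on_SucD: "Ck_on (Suc k) S u \<Longrightarrow> Ck_on k S u"
proof (induction k arbitrary: u)
  case 0
  then show ?case
    by (auto intro!: continuous_at_imp_continuous_on differentiable_imp_continuous_within)
next
  case (Suc k)
  then show ?case by (metis Ck_on.simps(2))
qed

lemma Ck_on_2D: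
  assumes "Ck_on 2 S u" "x \<in> S"
  shows "u differentiable (at x)" "dir v u differentiable (at x)"
  using assms by (auto simp: numeral_2_eq_2 simp del: split_paired_All)

lemma Ck_on_cong:
  assumes "open S" "\<And>x. x \<in> S \<Longrightarrow> f x = g x" "Ck_on k S f"
  shows "Ck_on k S g"
  using assms(2,3)
proof (induction k arbitrary: f g)
  case 0
  then show ?case by (metis Ck_on.simps(1) continuous_on_cong)
next
  case (Suc k)
  have "g differentiable (at x)" if "x \<in> S" for x
  proof -
    have "f differentiable (at x)"
      using Suc.prems(2) that by simp
    then obtain D where "(f has_derivative D) (at x)"
      unfolding differentiable_def ..
    then have "(g has_derivative D) (at x)"
      by (rule has_derivative_transform_within_open[OF _ assms(1) that Suc.prems(1)])
    then show ?thesis by (rule differentiableI)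
  qed
  moreover have "Ck_on k S (dir v g)" for v
  proof (rule Suc.IH[of "dir v f"])
    show "dir v f x = dir v g x" if "x \<in> S" for x
      by (rule dir_cong[OF assms(1) that Suc.prems(1)])
  qed (use Suc.prems in auto)
  ultimately show ?case by simp
qed

lemma Ck_on_bounded_linear:
  assumes "open S" "bounded_linear L" "Ck_on k S u"
  shows "Ck_on k S (\<lambda>x. L (u x))"
  using assms(3)
proof (induction k arbitrary: u)
  case 0
  then show ?case using assms(2) bounded_linear.continuous_on by auto
next
  case (Suc k)
  have *: "((\<lambda>x. L (u x)) has_derivative (\<lambda>v. L (dir v u x))) (at x)" if "x \<in> S" for x
    using Suc.prems that
    by (auto intro!: bounded_linear.has_derivative[OF assms(2)] has_derivative_dir)
  have "Ck_on k S (dir v (\<lambda>x. L (u x)))" for v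
    using dir_eqI[OF *] Suc by (intro Ck_on_cong[OF assms(1) _ Suc.IH]) auto
  then show ?case using * by (auto simp: differentiable_def)
qed

lemma Ck_on_const: "Ck_on k S (\<lambda>x. c)"
proof (induction k arbitrary: c)
  case (Suc k)
  have "dir v (\<lambda>x. c) = (\<lambda>x. 0)" for v :: 'a by (auto simp: deriv_along_def)
  then show ?case using Suc by simp
qed simp

lemma Ck_on_id: "Ck_on k S (\<lambda>x. x)"
proof (cases k)
  case (Suc k')
  have "dir v (\<lambda>x. x) = (\<lambda>x. v)" for v :: 'a by (auto simp: deriv_along_def)
  then show ?thesis using Suc Ck_on_const by auto
qed simp

lemma Ck_on_add:
  assumes "open S" "Ck_on k S u" "Ck_on k S w"
  shows "Ck_on k S (\<lambda>x. u x + w x)"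
  using assms(2,3)
proof (induction k arbitrary: u w)
  case 0
  then show ?case by (auto intro: continuous_on_add)
next
  case (Suc k)
  have *: "((\<lambda>x. u x + w x) has_derivative (\<lambda>v. dir v u x + dir v w x)) (at x)" if "x \<in> S" for x
    using Suc.prems that by (auto intro!: has_derivative_add has_derivative_dir)
  have "Ck_on k S (dir v (\<lambda>x. u x + w x))" for v
  proof (rule Ck_on_cong[OF assms(1)])
    show "Ck_on k S (\<lambda>x. dir v u x + dir v w x)"
      using Suc.prems by (intro Suc.IH) auto
  qed (use dir_eqI[OF *] in auto)
  then show ?case using * by (auto simp: differentiable_def)
qed

lemma Ck_on_bounded_bilinear:
  assumes "open S" "bounded_bilinear p" "Ck_on k S u" "Ck_on k S w"
  shows "Ck_on k S (\<lambda>x. p (u x) (w x))"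
  using assms(3,4)
proof (induction k arbitrary: u w)
  case 0
  then show ?case using assms(2) by (auto intro: bounded_bilinear.continuous_on)
next
  case (Suc k)
  have *: "((\<lambda>x. p (u x) (w x)) has_derivative (\<lambda>v. p (u x) (dir v w x) + p (dir v u x) (w x))) (at x)"
    if "x \<in> S" for x
    using Suc.prems that by (auto intro!: bounded_bilinear.FDERIV[OF assms(2)] has_derivative_dir)
  have "Ck_on k S (dir v (\<lambda>x. p (u x) (w x)))" for v
  proof (rule Ck_on_cong[OF assms(1)])
    \<comment> \<open>Each summand keeps one undifferentiated factor, known to order
      \<open>Suc k\<close>; \<open>Ck_on_SucD\<close> lowers it to the order of the induction
      hypothesis.\<close>
    show "Ck_on k S (\<lambda>x. p (u x) (dir v w x) + p (dir v u x) (w x))"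
      using Suc.prems Ck_on_SucD[OF Suc.prems(1)] Ck_on_SucD[OF Suc.prems(2)]
      by (intro Ck_on_add assms(1) Suc.IH) auto
  qed (use dir_eqI[OF *] in auto)
  then show ?case using * by (auto simp: differentiable_def)
qed

lemma Ck_on_inverse:
  fixes u :: "'a::real_normed_vector \<Rightarrow> real"
  assumes "open S" "Ck_on k S u" "\<And>x. x \<in> S \<Longrightarrow> u x \<noteq> 0"
  shows "Ck_on k S (\<lambda>x. inverse (u x))"
  using assms(2)
proof (induction k)
  case 0
  then show ?case using assms(3) by (auto intro: continuous_on_inverse)
next
  case (Suc k)
  have *: "((\<lambda>x. inverse (u x)) has_derivative (\<lambda>v. - (inverse (u x) * dir v u x * inverse (u x)))) (at x)"
    if "x \<in> S" for x
    using Suc.prems that by (intro Deriv.has_derivative_inverse assms(3) has_derivative_dir) auto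
  have "Ck_on k S (dir v (\<lambda>x. inverse (u x)))" for v
  proof (rule Ck_on_cong[OF assms(1)])
    \<comment> \<open>The derivative of the reciprocal contains the reciprocal again, one order
      lower: this is where the induction hypothesis enters.\<close>
    have I: "Ck_on k S (\<lambda>x. inverse (u x))"
      using Suc Ck_on_SucD by blast
    show "Ck_on k S (\<lambda>x. - (inverse (u x) * dir v u x * inverse (u x)))"
      using Suc.prems
      by (intro Ck_on_bounded_linear[OF assms(1) bounded_linear_minus[OF bounded_linear_ident]]
            Ck_on_bounded_bilinear[OF assms(1) bounded_bilinear_mult] I) auto
  qed (use dir_eqI[OF *] in auto)
  then show ?case using * by (auto simp: differentiable_def)
qed

lemma Ck_on_Pair:
  assumes "open S" "Ck_on k S u" "Ck_on k S w"
  shows "Ck_on k S (\<lambda>x. (u x, w x))"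
proof -
  have "Ck_on k S (\<lambda>x. (u x, 0) + (0, w x))"
    by (intro Ck_on_add assms(1) Ck_on_bounded_linear[OF assms(1) _ assms(2)]
         Ck_on_bounded_linear[OF assms(1) _ assms(3)] bounded_linear_Pair
         bounded_linear_ident bounded_linear_zero)
  then show ?thesis by simp
qed

lemma dir_bounded_bilinear:
  assumes "bounded_bilinear p" "u differentiable (at x)" "w differentiable (at x)"
  shows "dir v (\<lambda>x. p (u x) (w x)) x = p (u x) (dir v w x) + p (dir v u x) (w x)"
  by (rule dir_eqI, rule bounded_bilinear.FDERIV[OF assms(1)])
     (auto intro!: has_derivative_dir assms)

lemmas dir_inner = dir_bounded_bilinear[OF bounded_bilinear_inner]

lemma dir_bounded_linear:
  assumes "bounded_linear L" "u differentiable (at x)"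
  shows "dir v (\<lambda>x. L (u x)) x = L (dir v u x)"
  by (rule dir_eqI, rule bounded_linear.has_derivative[OF assms(1)])
     (auto intro!: has_derivative_dir assms)

lemma dir_compose:
  assumes "c differentiable (at x)" "g differentiable (at (c x))"
  shows "dir v (\<lambda>y. g (c y)) x = dir (dir v c x) g (c x)"
  by (rule dir_eqI)
     (rule has_derivative_compose[OF has_derivative_dir[OF assms(1)] has_derivative_dir[OF assms(2)]])

text \<open>The second difference over the parallelogram spanned by \<open>t *\<^sub>R a\<close> and \<open>t *\<^sub>R b\<close> is evaluated
  by two applications of the mean value theorem.\<close>

lemma second_difference_mvt:
  fixes u :: "'a::real_normed_vector \<Rightarrow> real"
  assumes t: "0 < t"
    and S: "\<And>r s. 0 \<le> r \<Longrightarrow> r \<le> t \<Longrightarrow> 0 \<le> s \<Longrightarrow> s \<le> t \<Longrightarrow> x + r *\<^sub>R a + s *\<^sub>R b \<in> S"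
    and d1: "\<And>y. y \<in> S \<Longrightarrow> u differentiable (at y)"
    and d2: "\<And>y. y \<in> S \<Longrightarrow> dir a u differentiable (at y)"
  obtains r s where "0 \<le> r" "r \<le> t" "0 \<le> s" "s \<le> t"
    "u (x + t *\<^sub>R a + t *\<^sub>R b) - u (x + t *\<^sub>R a) - u (x + t *\<^sub>R b) + u x =
       t\<^sup>2 * dir b (dir a u) (x + r *\<^sub>R a + s *\<^sub>R b)"
proof -
  let ?g = "\<lambda>r. u (x + r *\<^sub>R a + t *\<^sub>R b) - u (x + r *\<^sub>R a)"
  have da: "((\<lambda>r. u (x + r *\<^sub>R a + s *\<^sub>R b)) has_real_derivative dir a u (x + r *\<^sub>R a + s *\<^sub>R b)) (at r)"
    if "0 \<le> r" "r \<le> t" "0 \<le> s" "s \<le> t" for r s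
  proof -
    have "((\<lambda>r. u (x + r *\<^sub>R a + s *\<^sub>R b)) has_derivative
        (\<lambda>h. dir (h *\<^sub>R a) u (x + r *\<^sub>R a + s *\<^sub>R b))) (at r)"
      by (rule has_derivative_compose[where f = "\<lambda>r. x + r *\<^sub>R a + s *\<^sub>R b" and g = u, OF _ has_derivative_dir[OF d1[OF S[OF that]]]])
         (auto intro!: derivative_eq_intros)
    then show ?thesis
      by (simp add: has_field_derivative_def dir_scaleR[OF d1[OF S[OF that]]] mult_commute_abs)
  qed
  have db: "((\<lambda>s. dir a u (x + r *\<^sub>R a + s *\<^sub>R b)) has_real_derivative dir b (dir a u) (x + r *\<^sub>R a + s *\<^sub>R b)) (at s)"
    if "0 \<le> r" "r \<le> t" "0 \<le> s" "s \<le> t" for r s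
  proof -
    have "((\<lambda>s. dir a u (x + r *\<^sub>R a + s *\<^sub>R b)) has_derivative
        (\<lambda>h. dir (h *\<^sub>R b) (dir a u) (x + r *\<^sub>R a + s *\<^sub>R b))) (at s)"
      by (rule has_derivative_compose[where f = "\<lambda>s. x + r *\<^sub>R a + s *\<^sub>R b" and g = "dir a u", OF _ has_derivative_dir[OF d2[OF S[OF that]]]])
         (auto intro!: derivative_eq_intros)
    then show ?thesis
      by (simp add: has_field_derivative_def dir_scaleR[OF d2[OF S[OF that]]] mult_commute_abs)
  qed
  \<comment> \<open>The term \<open>0 *\<^sub>R b\<close> is kept so that the derivative of
    \<open>?g\<close> is itself an increment over the interval from 0 to \<open>t\<close> in the
    \<open>b\<close> direction, ready for the second mean value theorem.\<close>
  have gd: "(?g has_real_derivative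
      (dir a u (x + r *\<^sub>R a + t *\<^sub>R b) - dir a u (x + r *\<^sub>R a + 0 *\<^sub>R b))) (at r)"
    if "0 \<le> r" "r \<le> t" for r
    using DERIV_diff[OF da[of r t] da[of r 0]] that t by simp
  obtain r where r: "0 < r" "r < t"
    and r_eq: "?g t - ?g 0 = (t - 0) * (dir a u (x + r *\<^sub>R a + t *\<^sub>R b) - dir a u (x + r *\<^sub>R a + 0 *\<^sub>R b))"
    using MVT2[OF t gd] by blast
  have "0 \<le> r" "r \<le> t" using r by auto
  from MVT2[OF t db[OF this]]
  have "\<exists>s. 0 < s \<and> s < t \<and> dir a u (x + r *\<^sub>R a + t *\<^sub>R b) - dir a u (x + r *\<^sub>R a + 0 *\<^sub>R b) =
      (t - 0) * dir b (dir a u) (x + r *\<^sub>R a + s *\<^sub>R b)" .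
  then obtain s where s: "0 < s" "s < t"
    and "dir a u (x + r *\<^sub>R a + t *\<^sub>R b) - dir a u (x + r *\<^sub>R a + 0 *\<^sub>R b) =
      t * dir b (dir a u) (x + r *\<^sub>R a + s *\<^sub>R b)"
    by auto
  with r_eq have "?g t - ?g 0 = t\<^sup>2 * dir b (dir a u) (x + r *\<^sub>R a + s *\<^sub>R b)"
    by (simp add: power2_eq_square)
  then show ?thesis
    using that[of r s] r s by (simp add: algebra_simps)
qed

text \<open>The second difference is symmetric in \<open>a\<close> and \<open>b\<close>, so
  evaluating it in both orders equates the two mixed derivatives at two points of a small
  parallelogram; continuity moves both points to \<open>x\<close>.\<close>

lemma dir_commute_real:
  fixes u :: "'a::real_normed_vector \<Rightarrow> real"
  assumes S: "open S" "x \<in> S" and C: "Ck_on 2 S u"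
  shows "dir a (dir b u) x = dir b (dir a u) x"
proof -
  have d1: "\<And>y. y \<in> S \<Longrightarrow> u differentiable (at y)"
    and d2: "\<And>y v. y \<in> S \<Longrightarrow> dir v u differentiable (at y)"
    and cont: "\<And>v w. continuous_on S (dir w (dir v u))"
    using C by (auto simp: numeral_2_eq_2)
  have *: "\<bar>dir a (dir b u) x - dir b (dir a u) x\<bar> < e + e" if e: "0 < e" for e :: real
  proof -
    have "\<exists>d>0. \<forall>y. dist y x < d \<longrightarrow> \<bar>dir w (dir v u) y - dir w (dir v u) x\<bar> < e" for v w
      using cont[of w v] S e by (auto simp: continuous_on_eq_continuous_at continuous_at_eps_delta dist_real_def)
    then obtain d1' d2' where d: "d1' > 0" "d2' > 0"
      "\<And>y. dist y x < d1' \<Longrightarrow> \<bar>dir a (dir b u) y - dir a (dir b u) x\<bar> < e"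
      "\<And>y. dist y x < d2' \<Longrightarrow> \<bar>dir b (dir a u) y - dir b (dir a u) x\<bar> < e"
      by metis
    obtain d0 where d0: "d0 > 0" "ball x d0 \<subseteq> S" using S openE by blast
    \<comment> \<open>This size keeps the whole parallelogram within half of all three radii; the
      summand 1 keeps the denominator positive when \<open>a\<close> and \<open>b\<close>
      vanish.\<close>
    define t where "t = min d0 (min d1' d2') / (2 * (norm a + norm b + 1))"
    define D where "D = min d0 (min d1' d2')"
    have np: "norm a + norm b + 1 > 0" by (smt (verit) norm_ge_zero)
    have D: "D > 0" using d d0 by (simp add: D_def)
    then have t: "t > 0" unfolding t_def D_def[symmetric] using np by simp
    have tD: "t * (norm a + norm b + 1) = D / 2"
      unfolding t_def D_def[symmetric] using np by (simp add: field_simps)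
    have near: "dist (x + r *\<^sub>R a + s *\<^sub>R b) x < D"
      if "0 \<le> r" "r \<le> t" "0 \<le> s" "s \<le> t" for r s
    proof -
      have "norm (r *\<^sub>R a + s *\<^sub>R b) \<le> r * norm a + s * norm b"
        using norm_triangle_ineq[of "r *\<^sub>R a" "s *\<^sub>R b"] that by simp
      also have "\<dots> \<le> t * norm a + t * norm b"
        using that by (intro add_mono mult_right_mono) auto
      also have "\<dots> \<le> D / 2" using tD t by (simp add: algebra_simps)
      also have "\<dots> < D" using D by simp
      finally show ?thesis by (simp add: dist_norm add.assoc)
    qed
    have inS: "x + r *\<^sub>R a + s *\<^sub>R b \<in> S" if "0 \<le> r" "r \<le> t" "0 \<le> s" "s \<le> t" for r s
      using near[OF that] d0 by (auto simp: D_def dist_commute subset_eq)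
    have inS': "x + r *\<^sub>R b + s *\<^sub>R a \<in> S" if "0 \<le> r" "r \<le> t" "0 \<le> s" "s \<le> t" for r s
      using inS[of s r] that by (simp add: algebra_simps)
    obtain r s where rs: "0 \<le> r" "r \<le> t" "0 \<le> s" "s \<le> t"
      "u (x + t *\<^sub>R a + t *\<^sub>R b) - u (x + t *\<^sub>R a) - u (x + t *\<^sub>R b) + u x =
         t\<^sup>2 * dir b (dir a u) (x + r *\<^sub>R a + s *\<^sub>R b)"
      using second_difference_mvt[OF t inS d1 d2] by blast
    obtain r' s' where rs': "0 \<le> r'" "r' \<le> t" "0 \<le> s'" "s' \<le> t"
      "u (x + t *\<^sub>R b + t *\<^sub>R a) - u (x + t *\<^sub>R b) - u (x + t *\<^sub>R a) + u x =
         t\<^sup>2 * dir a (dir b u) (x + r' *\<^sub>R b + s' *\<^sub>R a)"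
      using second_difference_mvt[OF t inS' d1 d2] by blast
    have sw: "x + r' *\<^sub>R b + s' *\<^sub>R a = x + s' *\<^sub>R a + r' *\<^sub>R b"
      "x + t *\<^sub>R b + t *\<^sub>R a = x + t *\<^sub>R a + t *\<^sub>R b"
      by simp_all
    have e: "t\<^sup>2 * dir a (dir b u) (x + s' *\<^sub>R a + r' *\<^sub>R b) = t\<^sup>2 * dir b (dir a u) (x + r *\<^sub>R a + s *\<^sub>R b)"
      using rs(5) rs'(5)[unfolded sw] by linarith
    have t2: "t\<^sup>2 \<noteq> 0" using t by simp
    have eq: "dir a (dir b u) (x + s' *\<^sub>R a + r' *\<^sub>R b) = dir b (dir a u) (x + r *\<^sub>R a + s *\<^sub>R b)"
      by (rule mult_left_cancel[OF t2, THEN iffD1, OF e])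
    have "\<bar>dir a (dir b u) (x + s' *\<^sub>R a + r' *\<^sub>R b) - dir a (dir b u) x\<bar> < e"
      using near[of s' r'] rs' by (intro d) (auto simp: D_def)
    moreover have "\<bar>dir b (dir a u) (x + r *\<^sub>R a + s *\<^sub>R b) - dir b (dir a u) x\<bar> < e"
      using near[of r s] rs by (intro d) (auto simp: D_def)
    ultimately show ?thesis using eq by linarith
  qed
  show ?thesis
  proof (rule ccontr)
    assume "dir a (dir b u) x \<noteq> dir b (dir a u) x"
    then show False using *[of "\<bar>dir a (dir b u) x - dir b (dir a u) x\<bar> / 2"] by auto
  qed
qed

lemma dir_commute:
  fixes u :: "'a::real_normed_vector \<Rightarrow> 'b::euclidean_space"
  assumes S: "open S" "x \<in> S" and C: "Ck_on 2 S u"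
  shows "dir a (dir b u) x = dir b (dir a u) x"
proof (rule euclidean_eqI)
  fix c :: 'b
  have d1: "\<And>y. y \<in> S \<Longrightarrow> u differentiable (at y)"
    and d2: "\<And>y v. y \<in> S \<Longrightarrow> dir v u differentiable (at y)"
    using C by (auto simp: numeral_2_eq_2)
  have L: "bounded_linear (\<lambda>z. z \<bullet> c)" by (rule bounded_linear_inner_left)
  have 2: "dir v (dir w (\<lambda>y. u y \<bullet> c)) x = dir v (dir w u) x \<bullet> c" for v w
  proof -
    have "dir v (dir w (\<lambda>y. u y \<bullet> c)) x = dir v (\<lambda>y. dir w u y \<bullet> c) x"
      using S d1 by (intro dir_cong[of S]) (auto simp: dir_bounded_linear[OF L])
    then show ?thesis using dir_bounded_linear[OF L d2] S by simp
  qed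
  show "dir a (dir b u) x \<bullet> c = dir b (dir a u) x \<bullet> c"
    using dir_commute_real[OF S Ck_on_bounded_linear[OF S(1) L C], of a b] by (simp add: 2)
qed

section \<open>The connection induced by an immersion\<close>

text \<open>\<open>P\<close> is the pseudo-inverse: the inverse of
  \<open>adjoint A \<circ> A\<close>, which exists because \<open>A\<close> is injective, applied
  after \<open>adjoint A\<close>. Thus \<open>A \<circ> P\<close> is the orthogonal projection onto
  the range of \<open>A\<close>.\<close>

lemma tangential_projection:
  fixes A :: "'e::euclidean_space \<Rightarrow> 'v::euclidean_space"
  assumes A: "linear A" and inj: "\<And>u. A u = 0 \<Longrightarrow> u = 0"
  obtains P where "linear P" "\<And>z w. A (P z) \<bullet> A w = z \<bullet> A w"
proof -
  have lin: "linear (adjoint A \<circ> A)"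
    by (intro linear_compose A adjoint_linear)
  have "u = 0" if "adjoint A (A u) = 0" for u
  proof -
    have "A u \<bullet> A u = 0" using that adjoint_works[OF A, of u "A u"] by simp
    then show ?thesis using inj by simp
  qed
  then have "inj (adjoint A \<circ> A)"
    using lin by (simp add: linear_injective_0)
  then obtain Q where Q: "linear Q" "\<And>z. adjoint A (A (Q z)) = z"
    using lin linear_injective_isomorphism[of "adjoint A \<circ> A"] by auto
  have "A (Q (adjoint A z)) \<bullet> A w = z \<bullet> A w" for z w
    using adjoint_works[OF A, of w] Q(2)[of "adjoint A z"] by (metis inner_commute)
  then show ?thesis
    using that[of "Q \<circ> adjoint A"] Q(1) linear_compose[OF adjoint_linear[OF A] Q(1)] by simp
qed

text \<open>Differentiating the induced metric by the product rule shows that the tangential part of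
  the second derivative is a metric connection; it is torsion-free because second derivatives
  commute. Uniqueness is the classical Koszul argument.\<close>

lemma christoffel_immersion:
  fixes M :: "('i, 'm, 'e::euclidean_space) riem" and \<psi> :: "'e \<Rightarrow> 'v::euclidean_space"
  assumes S: "open S" "x \<in> S" and C: "Ck_on 2 S \<psi>"
    and G: "\<And>y u v. y \<in> S \<Longrightarrow> metr M i y u v = dir u \<psi> y \<bullet> dir v \<psi> y"
    and inj: "\<And>u. dir u \<psi> x = 0 \<Longrightarrow> u = 0"
  shows "bilinear (christoffel M i x)"
    and "\<And>u v. christoffel M i x u v = christoffel M i x v u"
    and "\<And>u v w. dir (christoffel M i x u v) \<psi> x \<bullet> dir w \<psi> x = dir u (dir v \<psi>) x \<bullet> dir w \<psi> x"
proof -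
  have d1: "\<And>y. y \<in> S \<Longrightarrow> \<psi> differentiable (at y)"
    and d2: "\<And>y v. y \<in> S \<Longrightarrow> dir v \<psi> differentiable (at y)"
    using C by (auto simp: numeral_2_eq_2)
  note [simp] = d1[OF S(2)] d2[OF S(2)]
  have comm: "dir a (dir b \<psi>) x = dir b (dir a \<psi>) x" for a b
    by (rule dir_commute[OF S C])
  obtain P where P: "linear P" "\<And>z w. dir (P z) \<psi> x \<bullet> dir w \<psi> x = z \<bullet> dir w \<psi> x"
    using tangential_projection[OF linear_dir[OF d1[OF S(2)]] inj] by blast
  define \<Gamma> where "\<Gamma> = (\<lambda>u v. P (dir u (dir v \<psi>) x))"
  let ?Q = "\<lambda>\<Gamma>. bilinear \<Gamma> \<and> (\<forall>u v. \<Gamma> u v = \<Gamma> v u) \<and>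
     (\<forall>w u v. dir w (\<lambda>y. metr M i y u v) x = metr M i x (\<Gamma> w u) v + metr M i x u (\<Gamma> w v))"
  have dG: "dir w (\<lambda>y. metr M i y u v) x
      = dir u \<psi> x \<bullet> dir w (dir v \<psi>) x + dir w (dir u \<psi>) x \<bullet> dir v \<psi> x" for w u v
  proof -
    have "dir w (\<lambda>y. metr M i y u v) x = dir w (\<lambda>y. dir u \<psi> y \<bullet> dir v \<psi> y) x"
      by (rule dir_cong[OF S G])
    then show ?thesis by (simp add: dir_inner)
  qed
  have sym: "\<Gamma> u v = \<Gamma> v u" for u v by (simp add: \<Gamma>_def comm)
  have lin: "linear (\<lambda>u. \<Gamma> u v)" for v
    unfolding \<Gamma>_def
    using linear_compose[OF linear_dir P(1), of "dir v \<psi>" x] by (simp add: o_def)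
  have bil: "bilinear \<Gamma>"
    unfolding bilinear_def using lin by (simp add: sym[of _ v for v] sym)
  have Q: "?Q \<Gamma>"
    using bil sym by (simp add: dG G[OF S(2)] \<Gamma>_def P(2) inner_commute[of "dir _ \<psi> x" "dir (P _) \<psi> x"])
      (simp add: inner_commute)
  have "\<Gamma>' = \<Gamma>" if "?Q \<Gamma>'" for \<Gamma>'
  proof (intro ext)
    fix w u
    \<comment> \<open>\<open>T\<close> is the lowered difference of two candidate connections. It is
      symmetric in its first two arguments and skew in its last two, which forces it to
      vanish.\<close>
    define T where "T = (\<lambda>w u v. (dir (\<Gamma>' w u) \<psi> x - dir (\<Gamma> w u) \<psi> x) \<bullet> dir v \<psi> x)"
    have anti: "T w u v = - T w v u" for w u v
    proof -
      have "metr M i x (\<Gamma>' w u) v + metr M i x u (\<Gamma>' w v)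
          = metr M i x (\<Gamma> w u) v + metr M i x u (\<Gamma> w v)"
        using that[THEN conjunct2, THEN conjunct2, rule_format, of w u v]
          Q[THEN conjunct2, THEN conjunct2, rule_format, of w u v] by linarith
      then show ?thesis
        unfolding T_def G[OF S(2)] inner_diff_left
        using inner_commute[of "dir u \<psi> x" "dir (\<Gamma>' w v) \<psi> x"]
          inner_commute[of "dir u \<psi> x" "dir (\<Gamma> w v) \<psi> x"] by linarith
    qed
    have symT: "T w u v = T u w v" for w u v
      unfolding T_def using that[THEN conjunct2, THEN conjunct1, rule_format, of w u] sym[of w u] by simp
    \<comment> \<open>Alternating the two symmetries three times each returns to the same arguments
      with the opposite sign.\<close>
    have T0: "T w u v = 0" for v
      using anti[of w u v] symT[of w v u] anti[of v w u] symT[of v u w] anti[of u v w] symT[of u w v] by linarith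
    have "dir (\<Gamma>' w u - \<Gamma> w u) \<psi> x = dir (\<Gamma>' w u) \<psi> x - dir (\<Gamma> w u) \<psi> x"
      by (rule linear_diff[OF linear_dir]) simp
    then have "dir (\<Gamma>' w u - \<Gamma> w u) \<psi> x \<bullet> dir (\<Gamma>' w u - \<Gamma> w u) \<psi> x = 0"
      using T0[of "\<Gamma>' w u - \<Gamma> w u"] by (simp add: T_def)
    then show "\<Gamma>' w u = \<Gamma> w u" using inj[of "\<Gamma>' w u - \<Gamma> w u"] by simp
  qed
  then have eq: "christoffel M i x = \<Gamma>"
    unfolding christoffel_def using Q by (intro the_equality) auto
  show "bilinear (christoffel M i x)" "\<And>u v. christoffel M i x u v = christoffel M i x v u"
    using bil sym eq by auto
  show "\<And>u v w. dir (christoffel M i x u v) \<psi> x \<bullet> dir w \<psi> x = dir u (dir v \<psi>) x \<bullet> dir w \<psi> x"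
    by (simp add: eq \<Gamma>_def P(2))
qed

text \<open>Product and chain rule for a derivative whose base point and direction both move.
  Expanding the direction in \<open>Basis\<close> leaves only derivatives in fixed directions to be
  differentiated.\<close>

lemma dir_moving_direction:
  fixes c :: "'e::real_normed_vector \<Rightarrow> 'g::euclidean_space" and g :: "'g \<Rightarrow> 'z::real_normed_vector"
  assumes U: "open U" "x \<in> U" and S: "open S" "c ` U \<subseteq> S"
    and g: "\<And>y. y \<in> S \<Longrightarrow> g differentiable (at y)"
    and g2: "\<And>w. dir w g differentiable (at (c x))"
    and c: "c differentiable (at x)" and V: "V differentiable (at x)"
  shows "dir h (\<lambda>y. dir (V y) g (c y)) x
    = dir (dir h c x) (dir (V x) g) (c x) + dir (dir h V x) g (c x)"
proof -
  have expand: "dir v g y = (\<Sum>b\<in>Basis. (v \<bullet> b) *\<^sub>R dir b g y)" if "y \<in> S" for v y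
  proof -
    have "dir v g y = dir (\<Sum>b\<in>Basis. (v \<bullet> b) *\<^sub>R b) g y"
      by (simp add: euclidean_representation)
    then show ?thesis
      by (simp add: linear_sum[OF linear_dir[OF g[OF that]]] dir_scaleR[OF g[OF that]])
  qed
  have cx: "c x \<in> S" using U S by auto
  have *: "((\<lambda>y. (V y \<bullet> b) *\<^sub>R dir b g (c y)) has_derivative
      (\<lambda>h. (V x \<bullet> b) *\<^sub>R dir (dir h c x) (dir b g) (c x) + (dir h V x \<bullet> b) *\<^sub>R dir b g (c x))) (at x)" for b
    by (rule bounded_bilinear.FDERIV[OF bounded_bilinear_scaleR])
       (auto intro!: has_derivative_inner_left has_derivative_dir V
          has_derivative_compose[OF has_derivative_dir[OF c] has_derivative_dir[OF g2]])
  have "dir h (\<lambda>y. dir (V y) g (c y)) x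
      = dir h (\<lambda>y. \<Sum>b\<in>Basis. (V y \<bullet> b) *\<^sub>R dir b g (c y)) x"
    by (rule dir_cong[OF U]) (use S in \<open>auto intro!: expand\<close>)
  also have "\<dots> = (\<Sum>b\<in>Basis. (V x \<bullet> b) *\<^sub>R dir (dir h c x) (dir b g) (c x) + (dir h V x \<bullet> b) *\<^sub>R dir b g (c x))"
    by (rule dir_eqI, rule has_derivative_sum, rule *)
  also have "\<dots> = (\<Sum>b\<in>Basis. (V x \<bullet> b) *\<^sub>R dir (dir h c x) (dir b g) (c x)) + dir (dir h V x) g (c x)"
    by (simp add: sum.distrib expand[OF cx, of "dir h V x"])
  also have "(\<Sum>b\<in>Basis. (V x \<bullet> b) *\<^sub>R dir (dir h c x) (dir b g) (c x)) = dir (dir h c x) (dir (V x) g) (c x)"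
  proof -
    have "dir (dir h c x) (dir (V x) g) (c x)
        = dir (dir h c x) (\<lambda>y. \<Sum>b\<in>Basis. (V x \<bullet> b) *\<^sub>R dir b g y) (c x)"
      by (rule dir_cong[OF S(1) cx]) (rule expand)
    also have "\<dots> = (\<Sum>b\<in>Basis. (V x \<bullet> b) *\<^sub>R dir (dir h c x) (dir b g) (c x))"
      by (rule dir_eqI, rule has_derivative_sum)
         (intro has_derivative_scaleR_right has_derivative_dir g2)
    finally show ?thesis ..
  qed
  finally show ?thesis .
qed

text \<open>The derivative of \<open>Y\<close> along \<open>X\<close> enters both covariant
  derivatives and cancels. What is left depends only on the values of the fields at
  \<open>x\<close>, so the second fundamental form is tensorial.\<close>

lemma second_ff_eq:
  assumes U: "open U" "x \<in> U" and C: "Ck_on 2 U (coord_rep M N \<phi> i k)"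
    and Y: "Y differentiable (at x)"
  shows "second_ff M N \<phi> i k X Y x =
    dir (X x) (dir (Y x) (coord_rep M N \<phi> i k)) x
    + christoffel N k (coord_rep M N \<phi> i k x) (dir (X x) (coord_rep M N \<phi> i k) x) (dir (Y x) (coord_rep M N \<phi> i k) x)
    - dir (christoffel M i x (X x) (Y x)) (coord_rep M N \<phi> i k) x"
proof -
  let ?c = "coord_rep M N \<phi> i k"
  have d1: "\<And>y. y \<in> U \<Longrightarrow> ?c differentiable (at y)"
    and d2: "\<And>y v. y \<in> U \<Longrightarrow> dir v ?c differentiable (at y)"
    using C by (auto simp: numeral_2_eq_2)
  have "dir (X x) (\<lambda>y. dir (Y y) ?c y) x
      = dir (dir (X x) (\<lambda>y. y) x) (dir (Y x) ?c) x + dir (dir (X x) Y x) ?c x"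
    by (rule dir_moving_direction[OF U U(1)]) (use U d1 d2 Y in auto)
  moreover have Y_eq: "deriv_along Y ?c = (\<lambda>y. dir (Y y) ?c y)"
    by (rule ext) (rule deriv_along_eq_dir)
  ultimately have "deriv_along X (deriv_along Y ?c) x
      = dir (X x) (dir (Y x) ?c) x + dir (dir (X x) Y x) ?c x"
    by (simp add: deriv_along_eq_dir[of X] Y_eq
        deriv_along_def[of "\<lambda>_. X x" "\<lambda>y. y"])
  moreover have "deriv_along (nabla M i X Y) ?c x
      = dir (dir (X x) Y x) ?c x + dir (christoffel M i x (X x) (Y x)) ?c x"
    using dir_add[OF d1[OF U(2)], of "dir (X x) Y x"]
    by (simp add: nabla_def deriv_along_eq_dir[of "nabla M i X Y"] deriv_along_eq_dir[of X])
  ultimately show ?thesis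
    by (simp add: second_ff_def nabla_along_def deriv_along_eq_dir[of X ?c] deriv_along_eq_dir[of Y ?c])
qed

section \<open>The Gauss equation of a warped product\<close>

lemma dir_fst:
  assumes "a differentiable (at (fst z))"
  shows "dir w (\<lambda>z. a (fst z)) z = dir (fst w) a (fst z)" "(\<lambda>z. a (fst z)) differentiable (at z)"
proof -
  have "((\<lambda>z. a (fst z)) has_derivative (\<lambda>w. dir (fst w) a (fst z))) (at z)"
    by (rule has_derivative_compose[OF has_derivative_fst[OF has_derivative_ident] has_derivative_dir[OF assms]])
  then show "dir w (\<lambda>z. a (fst z)) z = dir (fst w) a (fst z)" "(\<lambda>z. a (fst z)) differentiable (at z)"
    by (rule dir_eqI, rule differentiableI)
qed

lemma dir_snd:
  assumes "a differentiable (at (snd z))"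
  shows "dir w (\<lambda>z. a (snd z)) z = dir (snd w) a (snd z)" "(\<lambda>z. a (snd z)) differentiable (at z)"
proof -
  have "((\<lambda>z. a (snd z)) has_derivative (\<lambda>w. dir (snd w) a (snd z))) (at z)"
    by (rule has_derivative_compose[OF has_derivative_snd[OF has_derivative_ident] has_derivative_dir[OF assms]])
  then show "dir w (\<lambda>z. a (snd z)) z = dir (snd w) a (snd z)" "(\<lambda>z. a (snd z)) differentiable (at z)"
    by (rule dir_eqI, rule differentiableI)
qed

text \<open>The Gauss equation for the plane spanned by a base vector \<open>u\<close> and a fibre vector \<open>v\<close>,
  with the sectional curvature of the warped product already evaluated.\<close>

lemma warped_gauss:
  fixes \<psi> :: "'b::euclidean_space \<times> 'd::euclidean_space \<Rightarrow> 'v::euclidean_space"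
  assumes U: "open U" "z0 \<in> U" and C: "Ck_on 3 U \<psi>"
    and hor: "\<And>z u u'. z \<in> U \<Longrightarrow> dir (u, 0) \<psi> z \<bullet> dir (u', 0) \<psi> z = gB (fst z) u u'"
    and mix: "\<And>z u v. z \<in> U \<Longrightarrow> dir (u, 0) \<psi> z \<bullet> dir (0, v) \<psi> z = 0"
    and ver: "\<And>z v v'. z \<in> U \<Longrightarrow> dir (0, v) \<psi> z \<bullet> dir (0, v') \<psi> z = (\<rho> (fst z))\<^sup>2 * gF (snd z) v v'"
    and gB: "\<And>z u u'. z \<in> U \<Longrightarrow> (\<lambda>x. gB x u u') differentiable (at (fst z))"
    and gF: "\<And>z v v'. z \<in> U \<Longrightarrow> (\<lambda>y. gF y v v') differentiable (at (snd z))"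
    and \<rho>1: "\<And>z. z \<in> U \<Longrightarrow> \<rho> differentiable (at (fst z))"
    and \<rho>2: "\<And>z u. z \<in> U \<Longrightarrow> dir u \<rho> differentiable (at (fst z))"
    and \<rho>0: "\<rho> (fst z0) \<noteq> 0"
    and \<Gamma>: "\<And>p q w. dir (\<Gamma> p q) \<psi> z0 \<bullet> dir w \<psi> z0 = dir p (dir q \<psi>) z0 \<bullet> dir w \<psi> z0"
  defines "h \<equiv> \<lambda>p q. dir p (dir q \<psi>) z0 - dir (\<Gamma> p q) \<psi> z0"
  shows "h (u, 0) (u, 0) \<bullet> h (0, v) (0, v) - h (u, 0) (0, v) \<bullet> h (u, 0) (0, v) =
    \<rho> (fst z0) * gF (snd z0) v v *
      (dir (fst (\<Gamma> (u, 0) (u, 0))) \<rho> (fst z0) - dir u (dir u \<rho>) (fst z0))"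
proof -
  have d1: "\<And>y. y \<in> U \<Longrightarrow> \<psi> differentiable (at y)"
    and d2: "\<And>y v. y \<in> U \<Longrightarrow> dir v \<psi> differentiable (at y)"
    and d3: "\<And>y v w. y \<in> U \<Longrightarrow> dir w (dir v \<psi>) differentiable (at y)"
    and C2': "\<And>v. Ck_on 2 U (dir v \<psi>)"
    using C by (auto simp: eval_nat_numeral)
  have C2: "Ck_on 2 U \<psi>" using C Ck_on_SucD[of 2 U \<psi>] by (simp add: eval_nat_numeral del: Ck_on.simps)
  have comm: "dir a (dir b \<psi>) z = dir b (dir a \<psi>) z" if "z \<in> U" for a b z
    by (rule dir_commute[OF U(1) that C2])
  have mix_diff: "dir (u, 0) \<psi> z \<bullet> dir w (dir (0, v) \<psi>) z + dir w (dir (u, 0) \<psi>) z \<bullet> dir (0, v) \<psi> z = 0"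
    if "z \<in> U" for z u v w
  proof -
    have "dir w (\<lambda>z. dir (u, 0) \<psi> z \<bullet> dir (0, v) \<psi> z) z = dir w (\<lambda>z. 0) z"
      by (rule dir_cong[OF U(1) that mix])
    then show ?thesis using that by (simp add: dir_inner d2 dir_const)
  qed
  have hor_diff: "dir (u, 0) \<psi> z \<bullet> dir (0, v) (dir (u', 0) \<psi>) z
      + dir (0, v) (dir (u, 0) \<psi>) z \<bullet> dir (u', 0) \<psi> z = 0"
    if "z \<in> U" for z u u' v
  proof -
    have "dir (0, v) (\<lambda>z. dir (u, 0) \<psi> z \<bullet> dir (u', 0) \<psi> z) z = dir (0, v) (\<lambda>z. gB (fst z) u u') z"
      by (rule dir_cong[OF U(1) that hor])
    also have "\<dots> = 0"
      using dir_fst(1)[OF gB[OF that], of "(0, v)" u u'] by (simp add: dir_zero gB[OF that])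
    finally show ?thesis using that by (simp add: dir_inner d2)
  qed
  have ver_diff: "dir (0, v) \<psi> z \<bullet> dir (u, 0) (dir (0, v') \<psi>) z
      + dir (u, 0) (dir (0, v) \<psi>) z \<bullet> dir (0, v') \<psi> z
      = 2 * \<rho> (fst z) * dir u \<rho> (fst z) * gF (snd z) v v'"
    if "z \<in> U" for z u v v'
  proof -
    have "dir (u, 0) (\<lambda>z. dir (0, v) \<psi> z \<bullet> dir (0, v') \<psi> z) z
        = dir (u, 0) (\<lambda>z. (\<rho> (fst z))\<^sup>2 * gF (snd z) v v') z"
      by (rule dir_cong[OF U(1) that ver])
    also have "\<dots> = 2 * \<rho> (fst z) * dir u \<rho> (fst z) * gF (snd z) v v'"
    proof -
      have r: "((\<lambda>z. \<rho> (fst z)) has_derivative (\<lambda>w. dir (fst w) \<rho> (fst z))) (at z)"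
        using has_derivative_dir[OF dir_fst(2)[OF \<rho>1[OF that]]] by (simp add: dir_fst(1)[OF \<rho>1[OF that]])
      have g: "((\<lambda>z. gF (snd z) v v') has_derivative (\<lambda>w. dir (snd w) (\<lambda>y. gF y v v') (snd z))) (at z)"
        using has_derivative_dir[OF dir_snd(2)[OF gF[OF that]]] by (simp add: dir_snd(1)[OF gF[OF that]])
      show ?thesis
        by (rule trans[OF dir_eqI[OF has_derivative_mult[OF has_derivative_power[OF r] g]]])
           (simp add: dir_zero gF[OF that])
    qed
    finally show ?thesis using that by (simp add: dir_inner d2)
  qed
  \<comment> \<open>The two mixed identities equate the products of \<open>u\<close> with the
    derivative along \<open>u'\<close>, \<open>v\<close> and of \<open>u'\<close> with that along
    \<open>u\<close>, \<open>v\<close>; the horizontal identity says that they are opposite, so both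
    vanish, and then so does the remaining product.\<close>
  have pq_hor: "dir (u, 0) (dir (0, v) \<psi>) z \<bullet> dir (u', 0) \<psi> z = 0"
    and pp_ver: "dir (u, 0) (dir (u', 0) \<psi>) z \<bullet> dir (0, v) \<psi> z = 0"
    if z: "z \<in> U" for z u u' v
    using hor_diff[OF z, of u v u'] mix_diff[OF z, of u "(u', 0)" v] mix_diff[OF z, of u' "(u, 0)" v]
      comm[OF z, of "(u, 0)" "(u', 0)"] comm[OF z, of "(u, 0)" "(0, v)"] comm[OF z, of "(u', 0)" "(0, v)"]
    by (simp_all add: inner_commute)
  \<comment> \<open>The same elimination: both summands of \<open>ver_diff\<close> are equal, so
    each is half of the right-hand side.\<close>
  have pq_ver: "dir (u, 0) (dir (0, v) \<psi>) z \<bullet> dir (0, v') \<psi> z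
      = \<rho> (fst z) * dir u \<rho> (fst z) * gF (snd z) v v'"
    if z: "z \<in> U" for z u v v'
    using ver_diff[OF z, of v u v'] mix_diff[OF z, of u "(0, v')" v] mix_diff[OF z, of u "(0, v)" v']
      comm[OF z, of "(0, v)" "(0, v')"] comm[OF z, of "(u, 0)" "(0, v)"] comm[OF z, of "(u, 0)" "(0, v')"]
    by (simp add: inner_commute)
  define p where "p = (u, 0 :: 'd)"
  define q where "q = (0 :: 'b, v)"
  define r where "r = \<rho> (fst z0)"
  define \<gamma> where "\<gamma> = gF (snd z0) v v"
  define ru where "ru = dir u \<rho> (fst z0)"
  define ruu where "ruu = dir u (dir u \<rho>) (fst z0)"
  define r\<Gamma> where "r\<Gamma> = dir (fst (\<Gamma> p p)) \<rho> (fst z0)"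
  have split: "dir w \<psi> z0 = dir (fst w, 0) \<psi> z0 + dir (0, snd w) \<psi> z0" for w
    using dir_add[OF d1[OF U(2)], of "(fst w, 0)" "(0, snd w)"] by simp
  \<comment> \<open>\<open>pq_ver\<close> differentiated along \<open>p\<close>. The third
    derivative of \<psi> that appears here returns in \<open>pp_qq\<close>.\<close>
  have third: "dir (0, v) \<psi> z0 \<bullet> dir p (dir p (dir q \<psi>)) z0 + dir p (dir q \<psi>) z0 \<bullet> dir p (dir q \<psi>) z0
      = (ru\<^sup>2 + r * ruu) * \<gamma>"
  proof -
    have a: "dir p (dir q \<psi>) z \<bullet> dir q \<psi> z = \<rho> (fst z) * dir u \<rho> (fst z) * gF (snd z) v v" if "z \<in> U" for z
      using pq_ver[OF that] by (simp add: p_def q_def)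
    have "dir p (\<lambda>z. dir p (dir q \<psi>) z \<bullet> dir q \<psi> z) z0
        = dir p (\<lambda>z. \<rho> (fst z) * dir u \<rho> (fst z) * gF (snd z) v v) z0"
      by (rule dir_cong[OF U a])
    also have "\<dots> = (ru\<^sup>2 + r * ruu) * \<gamma>"
    proof -
      have r1: "((\<lambda>z. \<rho> (fst z)) has_derivative (\<lambda>w. dir (fst w) \<rho> (fst z0))) (at z0)"
        using has_derivative_dir[OF dir_fst(2)[OF \<rho>1[OF U(2)]]] by (simp add: dir_fst(1)[OF \<rho>1[OF U(2)]])
      have r2: "((\<lambda>z. dir u \<rho> (fst z)) has_derivative (\<lambda>w. dir (fst w) (dir u \<rho>) (fst z0))) (at z0)"
        using has_derivative_dir[OF dir_fst(2)[OF \<rho>2[OF U(2)]]] by (simp add: dir_fst(1)[OF \<rho>2[OF U(2)]])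
      have g: "((\<lambda>z. gF (snd z) v v) has_derivative (\<lambda>w. dir (snd w) (\<lambda>y. gF y v v) (snd z0))) (at z0)"
        using has_derivative_dir[OF dir_snd(2)[OF gF[OF U(2)]]] by (simp add: dir_snd(1)[OF gF[OF U(2)]])
      show ?thesis
        by (rule trans[OF dir_eqI[OF has_derivative_mult[OF has_derivative_mult[OF r1 r2] g]]])
           (simp add: p_def dir_zero gF[OF U(2)] r_def ru_def ruu_def \<gamma>_def power2_eq_square algebra_simps)
    qed
    finally show ?thesis
      using U(2) by (simp add: dir_inner d2 d3 inner_commute q_def)
  qed
  \<comment> \<open>\<open>pp_ver\<close> differentiated along \<open>q\<close>. Commuting
    derivatives puts the third derivative into the order used in \<open>third\<close>, so
    subtracting the two identities removes it.\<close>
  have pp_qq: "dir p (dir p \<psi>) z0 \<bullet> dir q (dir q \<psi>) z0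
      + dir q \<psi> z0 \<bullet> dir p (dir p (dir q \<psi>)) z0 = 0"
  proof -
    have "dir q (\<lambda>z. dir p (dir p \<psi>) z \<bullet> dir q \<psi> z) z0 = dir q (\<lambda>z. 0) z0"
      by (rule dir_cong[OF U]) (simp add: p_def q_def pp_ver)
    moreover have "dir q (dir p (dir p \<psi>)) z0 = dir p (dir p (dir q \<psi>)) z0"
    proof -
      have "dir q (dir p (dir p \<psi>)) z0 = dir p (dir q (dir p \<psi>)) z0"
        by (rule dir_commute[OF U C2'])
      also have "\<dots> = dir p (dir p (dir q \<psi>)) z0"
        by (rule dir_cong[OF U comm])
      finally show ?thesis .
    qed
    ultimately show ?thesis
      using U(2) by (simp add: dir_inner d2 d3 dir_const inner_commute)
  qed
  \<comment> \<open>The tangential part of the mixed second derivative is the image of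
    \<open>q\<close> scaled by \<open>ru / r\<close>. Only its squared length matters, and for this
    it suffices to know the product of \<open>v\<close> with the fibre component.\<close>
  have t_pq: "dir (\<Gamma> p q) \<psi> z0 \<bullet> dir (\<Gamma> p q) \<psi> z0 = ru\<^sup>2 * \<gamma>"
  proof -
    let ?\<beta> = "snd (\<Gamma> p q)"
    have s: "dir p (dir q \<psi>) z0 \<bullet> dir (\<Gamma> p q) \<psi> z0 = r * ru * gF (snd z0) v ?\<beta>"
      using pq_hor[OF U(2)] pq_ver[OF U(2)]
      unfolding split[of "\<Gamma> p q"] by (simp add: inner_add_right p_def q_def r_def ru_def)
    have "dir (\<Gamma> p q) \<psi> z0 \<bullet> dir (0, v) \<psi> z0 = r\<^sup>2 * gF (snd z0) v ?\<beta>"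
      unfolding split[of "\<Gamma> p q"] inner_add_left
      using mix[OF U(2), of "fst (\<Gamma> p q)" v] ver[OF U(2), of v ?\<beta>]
      by (simp add: inner_commute r_def)
    then have "r\<^sup>2 * gF (snd z0) v ?\<beta> = r * ru * \<gamma>"
      using pq_ver[OF U(2)] by (simp add: \<Gamma> p_def q_def r_def ru_def \<gamma>_def)
    then have "r * gF (snd z0) v ?\<beta> = ru * \<gamma>"
      using \<rho>0 by (simp add: r_def power2_eq_square)
    then have "r * ru * gF (snd z0) v ?\<beta> = ru\<^sup>2 * \<gamma>"
      by (simp add: power2_eq_square algebra_simps)
    then show ?thesis using s by (simp add: \<Gamma>)
  qed
  \<comment> \<open>The lifts of the base are totally geodesic: the fibre part of
    \<open>\<Gamma> p p\<close> is mapped to a vector orthogonal to itself. The horizontal part sees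
    the bending of the fibres, which is governed by the derivative of \<rho>.\<close>
  have t_pp: "dir q (dir q \<psi>) z0 \<bullet> dir (\<Gamma> p p) \<psi> z0 = - r * r\<Gamma> * \<gamma>"
  proof -
    let ?\<beta> = "snd (\<Gamma> p p)"
    have "dir (0, ?\<beta>) \<psi> z0 \<bullet> dir (0, ?\<beta>) \<psi> z0 = dir (\<Gamma> p p) \<psi> z0 \<bullet> dir (0, ?\<beta>) \<psi> z0"
      using mix[OF U(2)] by (simp add: split[of "\<Gamma> p p"] inner_add_left)
    also have "\<dots> = 0" using pp_ver[OF U(2)] by (simp add: \<Gamma> p_def)
    finally have "dir (0, ?\<beta>) \<psi> z0 = 0" by simp
    moreover have "dir q (dir q \<psi>) z0 \<bullet> dir (fst (\<Gamma> p p), 0) \<psi> z0 = - r * r\<Gamma> * \<gamma>"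
      using mix_diff[OF U(2), of "fst (\<Gamma> p p)" q v] pq_ver[OF U(2), of "fst (\<Gamma> p p)" v v]
        comm[OF U(2), of "(fst (\<Gamma> p p), 0)" q]
      by (simp add: q_def r_def r\<Gamma>_def \<gamma>_def inner_commute)
    ultimately show ?thesis
      by (simp add: split[of "\<Gamma> p p"] inner_add_right)
  qed
  \<comment> \<open>Two of the three products involving tangential parts cancel, because a
    tangential part and its full second derivative have the same product with every tangent
    vector.\<close>
  have "h p p \<bullet> h q q = dir p (dir p \<psi>) z0 \<bullet> dir q (dir q \<psi>) z0 - dir q (dir q \<psi>) z0 \<bullet> dir (\<Gamma> p p) \<psi> z0"
    using \<Gamma>[of p p "\<Gamma> q q"]
    by (simp add: h_def inner_diff_left inner_diff_right inner_commute)
  moreover have "h p q \<bullet> h p q = dir p (dir q \<psi>) z0 \<bullet> dir p (dir q \<psi>) z0 - dir (\<Gamma> p q) \<psi> z0 \<bullet> dir (\<Gamma> p q) \<psi> z0"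
    using \<Gamma>[of p q "\<Gamma> p q"]
    by (simp add: h_def inner_diff_left inner_diff_right inner_commute)
  ultimately have "h p p \<bullet> h q q - h p q \<bullet> h p q = r * \<gamma> * (r\<Gamma> - ruu)"
    using third pp_qq t_pq t_pp by (simp add: q_def algebra_simps)
  then show ?thesis
    by (simp add: p_def q_def r_def \<gamma>_def r\<Gamma>_def ruu_def)
qed

section \<open>Chen's inequality\<close>

text \<open>After expanding each \<open>b\<close> in \<open>Basis\<close>, Parseval's identity for
  the orthonormal basis \<open>B\<close> turns the coefficient matrix into the identity
  matrix.\<close>

lemma bilinear_trace_invariant:
  fixes h :: "'e::euclidean_space \<Rightarrow> 'e \<Rightarrow> 'v::real_vector"
  assumes h: "bilinear h" and B: "finite B" "pairwise orthogonal B" "\<And>b. b \<in> B \<Longrightarrow> norm b = 1" "span B = UNIV"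
  shows "(\<Sum>b\<in>B. h b b) = (\<Sum>i\<in>Basis. h i i)"
proof -
  have expand: "h b b = (\<Sum>i\<in>Basis. \<Sum>j\<in>Basis. ((b \<bullet> i) * (b \<bullet> j)) *\<^sub>R h i j)" for b
  proof -
    have "h b b = h (\<Sum>i\<in>Basis. (b \<bullet> i) *\<^sub>R i) (\<Sum>j\<in>Basis. (b \<bullet> j) *\<^sub>R j)"
      by (simp only: euclidean_representation)
    also have "\<dots> = (\<Sum>(i, j)\<in>Basis \<times> Basis. h ((b \<bullet> i) *\<^sub>R i) ((b \<bullet> j) *\<^sub>R j))"
      by (rule bilinear_sum[OF h])
    finally show ?thesis
      by (simp add: sum.cartesian_product[symmetric] bilinear_lmul[OF h] bilinear_rmul[OF h] mult.commute)
  qed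
  have parseval: "(\<Sum>b\<in>B. (b \<bullet> i) * (b \<bullet> j)) = i \<bullet> j" for i j
  proof -
    have "i \<bullet> j = (\<Sum>b\<in>B. (i \<bullet> b) *\<^sub>R b) \<bullet> j"
      using orthonormal_basis_expand[OF B(2,3) _ B(1), of i] B(4) by simp
    then show ?thesis by (simp add: inner_sum_left inner_commute[of i])
  qed
  have "(\<Sum>b\<in>B. h b b) = (\<Sum>i\<in>Basis. \<Sum>j\<in>Basis. \<Sum>b\<in>B. ((b \<bullet> i) * (b \<bullet> j)) *\<^sub>R h i j)"
    unfolding expand by (subst sum.swap, rule sum.cong[OF refl], rule sum.swap)
  also have "\<dots> = (\<Sum>i\<in>Basis. \<Sum>j\<in>Basis. (i \<bullet> j) *\<^sub>R h i j)"
    by (simp add: scaleR_sum_left[symmetric] parseval)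
  also have "\<dots> = (\<Sum>i\<in>Basis. h i i)"
    by (rule sum.cong[OF refl]) (simp add: inner_Basis if_distrib[of "\<lambda>c. c *\<^sub>R _"] cong: if_cong)
  finally show ?thesis .
qed

text \<open>With one argument of \<open>h\<close> frozen, the sum of squares over the other is the
  trace of a real bilinear form; trace invariance is applied to each slot in turn.\<close>

lemma bilinear_norm_invariant:
  fixes h :: "'e::euclidean_space \<Rightarrow> 'e \<Rightarrow> 'v::real_inner"
  assumes h: "bilinear h" and B: "finite B" "pairwise orthogonal B" "\<And>b. b \<in> B \<Longrightarrow> norm b = 1" "span B = UNIV"
  shows "(\<Sum>b\<in>B. \<Sum>c\<in>B. h b c \<bullet> h b c) = (\<Sum>i\<in>Basis. \<Sum>j\<in>Basis. h i j \<bullet> h i j)"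
proof -
  have 1: "bilinear (\<lambda>c c'. h b c \<bullet> h b c')" for b
    unfolding bilinear_def
    by (intro allI conjI linearI)
       (simp_all add: bilinear_radd[OF h] bilinear_rmul[OF h] inner_add_left inner_add_right)
  have 2: "bilinear (\<lambda>b b'. h b c \<bullet> h b' c)" for c
    unfolding bilinear_def
    by (intro allI conjI linearI)
       (simp_all add: bilinear_ladd[OF h] bilinear_lmul[OF h] inner_add_left inner_add_right)
  have "(\<Sum>b\<in>B. \<Sum>c\<in>B. h b c \<bullet> h b c) = (\<Sum>b\<in>B. \<Sum>j\<in>Basis. h b j \<bullet> h b j)"
    by (intro sum.cong refl bilinear_trace_invariant[OF 1 B])
  also have "\<dots> = (\<Sum>j\<in>Basis. \<Sum>b\<in>B. h b j \<bullet> h b j)"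
    by (rule sum.swap)
  also have "\<dots> = (\<Sum>j\<in>Basis. \<Sum>i\<in>Basis. h i j \<bullet> h i j)"
    by (intro sum.cong refl bilinear_trace_invariant[OF 2 B])
  also have "\<dots> = (\<Sum>i\<in>Basis. \<Sum>j\<in>Basis. h i j \<bullet> h i j)"
    by (rule sum.swap)
  finally show ?thesis .
qed

lemma norm_sum_squared_le:
  fixes w :: "'a \<Rightarrow> 'v::real_inner"
  shows "(\<Sum>i\<in>I. w i) \<bullet> (\<Sum>i\<in>I. w i) \<le> real (card I) * (\<Sum>i\<in>I. w i \<bullet> w i)"
proof -
  have "(norm (\<Sum>i\<in>I. w i))\<^sup>2 \<le> (\<Sum>i\<in>I. norm (w i))\<^sup>2"
    by (intro power_mono norm_sum norm_ge_zero)
  also have "\<dots> \<le> (\<Sum>i\<in>I. (norm (w i))\<^sup>2) * real (card I)"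
    by (rule sum_squared_le_sum_of_squares)
  finally show ?thesis by (simp add: power2_norm_eq_inner mult.commute)
qed

text \<open>Chen's algebraic lemma: complete \<open>\<xi>, \<eta>\<close> to an orthonormal basis and apply Cauchy-Schwarz to
  the trace, with the two terms for \<open>\<xi>\<close> and \<open>\<eta>\<close> grouped as one.\<close>

lemma chen_inequality:
  fixes h :: "'e::euclidean_space \<Rightarrow> 'e \<Rightarrow> 'v::real_inner"
  assumes h: "bilinear h" and sym: "\<And>u v. h u v = h v u"
    and \<xi>\<eta>: "norm \<xi> = 1" "norm \<eta> = 1" "\<xi> \<bullet> \<eta> = 0"
  defines "H \<equiv> \<Sum>i\<in>Basis. h i i"
  shows "(H \<bullet> H) / (2 * (real DIM('e) - 1)) - (\<Sum>i\<in>Basis. \<Sum>j\<in>Basis. h i j \<bullet> h i j) / 2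
    \<le> h \<xi> \<xi> \<bullet> h \<eta> \<eta> - h \<xi> \<eta> \<bullet> h \<xi> \<eta>"
proof -
  define S where "S = {x. x \<bullet> \<xi> = 0 \<and> x \<bullet> \<eta> = 0}"
  have "subspace S" by (auto simp: S_def subspace_def inner_add_left)
  then obtain C where C: "C \<subseteq> S" "pairwise orthogonal C" "\<And>x. x \<in> C \<Longrightarrow> norm x = 1"
    "independent C" "span C = S"
    by (metis orthonormal_basis_subspace)
  have finC: "finite C" using C(4) by (simp add: independent_imp_finite)
  have un: "\<xi> \<bullet> \<xi> = 1" "\<eta> \<bullet> \<eta> = 1" "\<eta> \<bullet> \<xi> = 0"
    using \<xi>\<eta> by (simp_all add: dot_square_norm inner_commute)
  have nC: "\<xi> \<notin> C" "\<eta> \<notin> C" "\<xi> \<noteq> \<eta>"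
    using C(1) un by (auto simp: S_def)
  define B where "B = insert \<xi> (insert \<eta> C)"
  have B: "finite B" "pairwise orthogonal B" "\<And>b. b \<in> B \<Longrightarrow> norm b = 1"
    using C finC \<xi>\<eta> un
    by (auto simp: B_def S_def pairwise_insert orthogonal_def inner_commute subset_eq)
  have spB: "span B = UNIV"
  proof (rule set_eqI, rule iffI)
    fix x :: 'e
    let ?y = "x - (x \<bullet> \<xi>) *\<^sub>R \<xi> - (x \<bullet> \<eta>) *\<^sub>R \<eta>"
    have "?y \<in> S" using un \<xi>\<eta> by (simp add: S_def inner_diff_left)
    then have "?y \<in> span B" using C(5) span_mono[of C B] by (metis B_def subset_insertI subset_trans in_mono)
    moreover have "\<xi> \<in> span B" "\<eta> \<in> span B" by (simp_all add: B_def span_base)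
    ultimately have "?y + (x \<bullet> \<eta>) *\<^sub>R \<eta> + (x \<bullet> \<xi>) *\<^sub>R \<xi> \<in> span B"
      by (intro span_add span_scale)
    then show "x \<in> span B" by simp
  qed simp
  have "independent B"
    using pairwise_orthogonal_independent[OF B(2)] B(3) by fastforce
  then have cardB: "card B = DIM('e)"
    using spB by (metis dim_UNIV dim_span dim_eq_card_independent)
  \<comment> \<open>Merging \<xi> and \<eta> into one summand leaves one term fewer than the
    dimension; \<xi> stands for the merged pair as an index.\<close>
  have n2: "real DIM('e) - 1 = real (card (insert \<xi> C))"
    using cardB nC finC by (simp add: B_def)
  have n1: "real DIM('e) - 1 > 0" unfolding n2 using finC nC by simp
  have trB: "H = h \<xi> \<xi> + h \<eta> \<eta> + (\<Sum>b\<in>C. h b b)"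
  proof -
    have "H = (\<Sum>b\<in>B. h b b)"
      unfolding H_def by (rule bilinear_trace_invariant[OF h B spB, symmetric])
    then show ?thesis using nC finC by (simp add: B_def add.assoc)
  qed
  define w where "w = (\<lambda>b. if b = \<xi> then h \<xi> \<xi> + h \<eta> \<eta> else h b b)"
  have wC: "(\<Sum>b\<in>C. w b) = (\<Sum>b\<in>C. h b b)" "(\<Sum>b\<in>C. w b \<bullet> w b) = (\<Sum>b\<in>C. h b b \<bullet> h b b)"
    using nC by (auto simp: w_def intro!: sum.cong)
  have "H = (\<Sum>b\<in>insert \<xi> C. w b)"
    using nC finC wC by (simp add: trB w_def)
  then have "H \<bullet> H \<le> real (card (insert \<xi> C)) * (\<Sum>b\<in>insert \<xi> C. w b \<bullet> w b)"
    using norm_sum_squared_le[of w "insert \<xi> C"] by simp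
  also have "(\<Sum>b\<in>insert \<xi> C. w b \<bullet> w b)
      = (h \<xi> \<xi> + h \<eta> \<eta>) \<bullet> (h \<xi> \<xi> + h \<eta> \<eta>) + (\<Sum>b\<in>C. h b b \<bullet> h b b)"
    using nC finC wC by (simp add: w_def)
  finally have 1: "(H \<bullet> H) / (real DIM('e) - 1)
      \<le> (h \<xi> \<xi> + h \<eta> \<eta>) \<bullet> (h \<xi> \<xi> + h \<eta> \<eta>) + (\<Sum>b\<in>C. h b b \<bullet> h b b)"
    using n1 by (simp add: n2 divide_le_eq mult.commute)
  have row: "h b b \<bullet> h b b \<le> (\<Sum>c\<in>B. h b c \<bullet> h b c)" if "b \<in> B" for b
    using B(1) that member_le_sum[of b B "\<lambda>c. h b c \<bullet> h b c"] by simp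
  have row2: "h b b \<bullet> h b b + h b c \<bullet> h b c \<le> (\<Sum>c\<in>B. h b c \<bullet> h b c)"
    if "b \<in> B" "c \<in> B" "b \<noteq> c" for b c
    using sum_mono2[of B "{b, c}" "\<lambda>c. h b c \<bullet> h b c"] that B(1) by simp
  have "(\<Sum>i\<in>Basis. \<Sum>j\<in>Basis. h i j \<bullet> h i j) = (\<Sum>b\<in>B. \<Sum>c\<in>B. h b c \<bullet> h b c)"
    by (rule bilinear_norm_invariant[OF h B spB, symmetric])
  also have "\<dots> = (\<Sum>c\<in>B. h \<xi> c \<bullet> h \<xi> c) + (\<Sum>c\<in>B. h \<eta> c \<bullet> h \<eta> c) + (\<Sum>b\<in>C. \<Sum>c\<in>B. h b c \<bullet> h b c)"
    using nC finC by (subst (1) B_def) simp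
  \<comment> \<open>The rows of \<xi> and \<eta> keep their diagonal entry and the entry for the
    pair, every other row only its diagonal entry. All discarded terms are squares.\<close>
  also have "\<dots> \<ge> (h \<xi> \<xi> \<bullet> h \<xi> \<xi> + h \<xi> \<eta> \<bullet> h \<xi> \<eta>) + (h \<eta> \<eta> \<bullet> h \<eta> \<eta> + h \<eta> \<xi> \<bullet> h \<eta> \<xi>)
      + (\<Sum>b\<in>C. h b b \<bullet> h b b)"
    using nC by (intro add_mono row2 sum_mono row) (auto simp: B_def)
  finally have 2: "(h \<xi> \<xi> \<bullet> h \<xi> \<xi> + h \<xi> \<eta> \<bullet> h \<xi> \<eta>) + (h \<eta> \<eta> \<bullet> h \<eta> \<eta> + h \<eta> \<xi> \<bullet> h \<eta> \<xi>)
      + (\<Sum>b\<in>C. h b b \<bullet> h b b) \<le> (\<Sum>i\<in>Basis. \<Sum>j\<in>Basis. h i j \<bullet> h i j)" .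
  have 3: "(H \<bullet> H) / (2 * (real DIM('e) - 1)) = ((H \<bullet> H) / (real DIM('e) - 1)) / 2"
    by simp
  \<comment> \<open>The square of the merged term contributes \<open>x\<close> twice and the two
    off-diagonal entries contribute \<open>y\<close> twice; the remaining diagonal squares
    \<open>a\<close>, \<open>b\<close>, \<open>c\<close> cancel, and halving gives
    \<open>x - y\<close>.\<close>
  have arith: "p / 2 - t / 2 \<le> x - y"
    if "p \<le> a + x + (x + b) + c" "a + y + (b + y) + c \<le> t" for a b c p t x y :: real
    using that by linarith
  show ?thesis
    unfolding 3 by (rule arith[OF 1[unfolded inner_add_left inner_add_right
      inner_commute[of "h \<eta> \<eta>" "h \<xi> \<xi>"]] 2[unfolded sym[of \<eta> \<xi>]]])
qed

text \<open>Chen's inequality for the metric pulled back by \<open>A\<close>, which in the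
  application is the differential of the immersion. The map \<open>L\<close> carries the standard
  basis to the frame, so \<open>A \<circ> L\<close> is an isometry and the Euclidean version applies
  to \<open>h\<close> composed with \<open>L\<close>.\<close>

lemma chen_inequality_frame:
  fixes h :: "'e::euclidean_space \<Rightarrow> 'e \<Rightarrow> 'v::real_inner" and A :: "'e \<Rightarrow> 'w::real_inner"
  assumes h: "bilinear h" and sym: "\<And>u v. h u v = h v u" and A: "linear A"
    and e: "\<And>a b. a < DIM('e) \<Longrightarrow> b < DIM('e) \<Longrightarrow> A (e a) \<bullet> A (e b) = (if a = b then 1 else 0)"
    and uv: "A u \<bullet> A u = 1" "A v \<bullet> A v = 1" "A u \<bullet> A v = 0"
  defines "H \<equiv> \<Sum>a<DIM('e). h (e a) (e a)"
  shows "(H \<bullet> H) / (2 * (real DIM('e) - 1)) - (\<Sum>a<DIM('e). \<Sum>b<DIM('e). h (e a) (e b) \<bullet> h (e a) (e b)) / 2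
    \<le> h u u \<bullet> h v v - h u v \<bullet> h u v"
proof -
  obtain \<beta> where \<beta>: "bij_betw \<beta> {..<DIM('e)} (Basis :: 'e set)"
    using ex_bij_betw_nat_finite[OF finite_Basis] by (auto simp: atLeast0LessThan)
  define L where "L = (\<lambda>w. \<Sum>a<DIM('e). (w \<bullet> \<beta> a) *\<^sub>R e a)"
  have L: "linear L"
    by (rule linearI) (simp_all add: L_def inner_add_left scaleR_add_left sum.distrib scaleR_sum_right)
  have Ls: "L (\<beta> a) = e a" if a: "a < DIM('e)" for a
  proof -
    have "\<beta> a \<bullet> \<beta> b = (if b = a then 1 else 0)" if "b < DIM('e)" for b
    proof -
      have "\<beta> a \<in> Basis" "\<beta> b \<in> Basis" "\<beta> a = \<beta> b \<longleftrightarrow> b = a"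
        using bij_betwE[OF \<beta>] inj_on_eq_iff[OF bij_betw_imp_inj_on[OF \<beta>]] a that by auto
      then show ?thesis by (simp add: inner_Basis)
    qed
    then have "L (\<beta> a) = (\<Sum>b<DIM('e). if b = a then e b else 0)"
      unfolding L_def by (intro sum.cong) auto
    then show ?thesis using a by simp
  qed
  have iso: "A (L w) \<bullet> A (L w') = w \<bullet> w'" for w w'
  proof -
    have "A (L w) \<bullet> A (L w') = (\<Sum>a<DIM('e). \<Sum>b<DIM('e). (w \<bullet> \<beta> a) * (w' \<bullet> \<beta> b) * (A (e a) \<bullet> A (e b)))"
    proof -
      have AL: "A (L w) = (\<Sum>a<DIM('e). (w \<bullet> \<beta> a) *\<^sub>R A (e a))" for w
        by (simp add: L_def linear_sum[OF A] linear_cmul[OF A])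
      show ?thesis
        unfolding AL inner_sum_left unfolding inner_sum_right by (simp add: mult.assoc mult.left_commute)
    qed
    also have "\<dots> = (\<Sum>a<DIM('e). \<Sum>b<DIM('e). if a = b then (w \<bullet> \<beta> a) * (w' \<bullet> \<beta> b) else 0)"
      by (intro sum.cong refl) (simp add: e)
    also have "\<dots> = (\<Sum>a<DIM('e). (w \<bullet> \<beta> a) * (w' \<bullet> \<beta> a))"
      by simp
    also have "\<dots> = (\<Sum>i\<in>Basis. (w \<bullet> i) * (w' \<bullet> i))"
      by (rule sum.reindex_bij_betw[OF \<beta>])
    finally show ?thesis by (simp add: euclidean_inner[of w w'])
  qed
  have "w = 0" if "L w = 0" for w
    using iso[of w w] that linear_0[OF A] by simp
  then have "surj L"
    using linear_injective_imp_surjective[OF L] by (simp add: linear_injective_0[OF L])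
  then obtain \<xi> \<eta> where \<xi>\<eta>: "u = L \<xi>" "v = L \<eta>" by (metis surjD)
  have bil: "bilinear (\<lambda>w w'. h (L w) (L w'))"
    unfolding bilinear_def
    by (intro allI conjI linearI)
       (simp_all add: linear_add[OF L] linear_cmul[OF L] bilinear_ladd[OF h] bilinear_radd[OF h]
         bilinear_lmul[OF h] bilinear_rmul[OF h])
  have "norm \<xi> = 1" "norm \<eta> = 1" "\<xi> \<bullet> \<eta> = 0"
    using uv by (simp_all add: \<xi>\<eta> iso norm_eq_sqrt_inner)
  note chen = chen_inequality[OF bil sym this]
  have "(\<Sum>i\<in>Basis. h (L i) (L i)) = H"
    unfolding H_def sum.reindex_bij_betw[OF \<beta>, symmetric] by (intro sum.cong) (auto simp: Ls)
  moreover have "(\<Sum>i\<in>Basis. \<Sum>j\<in>Basis. h (L i) (L j) \<bullet> h (L i) (L j))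
      = (\<Sum>a<DIM('e). \<Sum>b<DIM('e). h (e a) (e b) \<bullet> h (e a) (e b))"
    unfolding sum.reindex_bij_betw[OF \<beta>, symmetric] by (intro sum.cong) (auto simp: Ls)
  ultimately show ?thesis using chen by (simp add: \<xi>\<eta>)
qed

section \<open>Spheres and the torus\<close>

text \<open>Inverse of stereographic projection from the pole \<open>(0, s * r)\<close>, as a total
  function on the coordinate space. Writing it with \<open>inverse\<close> and
  \<open>*\<^sub>R\<close> fits the closure lemmas for \<open>Ck_on\<close>.\<close>

definition stereo_inv :: "real \<Rightarrow> real \<Rightarrow> 's::euclidean_space \<Rightarrow> 's \<times> real" where
  "stereo_inv r s x = inverse (x \<bullet> x + r\<^sup>2) *\<^sub>R ((2 * r\<^sup>2) *\<^sub>R x, s * r * (x \<bullet> x - r\<^sup>2))"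

lemma stereo_inv_on_sphere:
  assumes "0 < r" "s\<^sup>2 = 1"
  shows "stereo_inv r s x \<bullet> stereo_inv r s x = r\<^sup>2"
proof -
  define D where "D = x \<bullet> x + r\<^sup>2"
  have D: "D > 0" using assms by (simp add: D_def add_nonneg_pos)
  have "stereo_inv r s x \<bullet> stereo_inv r s x
      = (inverse D)\<^sup>2 * ((2 * r\<^sup>2) * (2 * r\<^sup>2) * (x \<bullet> x) + s\<^sup>2 * r\<^sup>2 * (x \<bullet> x - r\<^sup>2)\<^sup>2)"
    unfolding stereo_inv_def D_def[symmetric]
    by (simp add: power2_eq_square algebra_simps)
  also have "(2 * r\<^sup>2) * (2 * r\<^sup>2) * (x \<bullet> x) + s\<^sup>2 * r\<^sup>2 * (x \<bullet> x - r\<^sup>2)\<^sup>2 = r\<^sup>2 * D\<^sup>2"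
    unfolding assms(2) D_def by (simp add: power2_eq_square algebra_simps)
  finally show ?thesis using D by (simp add: power_inverse)
qed

lemma stereo_inv_denominator:
  assumes r: "0 < r" and s: "s\<^sup>2 = 1"
  shows "r - s * snd (stereo_inv r s x) = 2 * r ^ 3 / (x \<bullet> x + r\<^sup>2)"
    and "r - s * snd (stereo_inv r s x) \<noteq> 0"
proof -
  define D where "D = x \<bullet> x + r\<^sup>2"
  have D: "D > 0" using assms by (simp add: D_def add_nonneg_pos)
  have t: "r - s * snd (stereo_inv r s x) = 2 * r ^ 3 / D"
  proof -
    have "r - s * snd (stereo_inv r s x) = r - s\<^sup>2 * r * (x \<bullet> x - r\<^sup>2) / D"
    proof -
      have "snd (stereo_inv r s x) = s * r * (x \<bullet> x - r\<^sup>2) / D"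
        unfolding stereo_inv_def D_def[symmetric] by (simp add: divide_inverse mult.commute)
      then show ?thesis by (simp add: power2_eq_square)
    qed
    also have "\<dots> = (r * D - r * (x \<bullet> x - r\<^sup>2)) / D"
      using D s by (simp add: diff_divide_distrib)
    also have "\<dots> = 2 * r ^ 3 / D"
      by (simp add: D_def algebra_simps power2_eq_square power3_eq_cube)
    finally show ?thesis .
  qed
  then show "r - s * snd (stereo_inv r s x) = 2 * r ^ 3 / (x \<bullet> x + r\<^sup>2)"
    "r - s * snd (stereo_inv r s x) \<noteq> 0" using D r by (simp_all add: D_def)
qed

lemma stereo_map_inv:
  assumes r: "0 < r" and s: "s\<^sup>2 = 1"
  shows "stereo_inv r s x \<in> stereo_dom r s" and "stereo_map r s (stereo_inv r s x) = x"
proof -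
  define D where "D = x \<bullet> x + r\<^sup>2"
  have D: "D > 0" using assms by (simp add: D_def add_nonneg_pos)
  have t: "r - s * snd (stereo_inv r s x) = 2 * r ^ 3 / D"
    unfolding D_def by (rule stereo_inv_denominator[OF r s])
  have "norm (stereo_inv r s x) = r"
    using stereo_inv_on_sphere[OF r s, of x] r by (simp add: norm_eq_sqrt_inner)
  moreover have "stereo_inv r s x \<noteq> (0, s * r)"
  proof
    assume "stereo_inv r s x = (0, s * r)"
    then have "r - s * snd (stereo_inv r s x) = r - s\<^sup>2 * r" by (simp add: power2_eq_square)
    then show False using t s r D by simp
  qed
  ultimately show "stereo_inv r s x \<in> stereo_dom r s" by (simp add: stereo_dom_def)
  have "stereo_map r s (stereo_inv r s x)
      = (r / (r - s * snd (stereo_inv r s x))) *\<^sub>R fst (stereo_inv r s x)"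
    by (simp add: stereo_map_def case_prod_beta)
  also have "\<dots> = (r / (2 * r ^ 3 / D) * (2 * r\<^sup>2 / D)) *\<^sub>R x"
  proof -
    have "fst (stereo_inv r s x) = (2 * r\<^sup>2 / D) *\<^sub>R x"
      unfolding stereo_inv_def D_def[symmetric] by (simp add: divide_inverse mult.commute)
    then show ?thesis by (simp only: t scaleR_scaleR)
  qed
  also have "r / (2 * r ^ 3 / D) * (2 * r\<^sup>2 / D) = 1"
    using D r by (simp add: field_simps power2_eq_square power3_eq_cube)
  finally show "stereo_map r s (stereo_inv r s x) = x" by simp
qed

lemma stereo_inv_map:
  assumes r: "0 < r" and s: "s\<^sup>2 = 1" and z: "z \<in> stereo_dom r s"
  shows "stereo_inv r s (stereo_map r s z) = z"
proof -
  obtain y t where zt: "z = (y, t)" by force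
  have n: "y \<bullet> y + t\<^sup>2 = r\<^sup>2"
  proof -
    have "norm z = r" using z by (simp add: stereo_dom_def)
    then have "z \<bullet> z = r\<^sup>2" by (simp add: dot_square_norm)
    then show ?thesis by (simp add: zt power2_eq_square)
  qed
  define d where "d = r - s * t"
  \<comment> \<open>The denominator of the projection vanishes on the sphere only at the pole, which
    \<open>stereo_dom\<close> excludes.\<close>
  have "d \<noteq> 0"
  proof
    assume "d = 0"
    then have "s\<^sup>2 * t = s * r" by (simp add: d_def power2_eq_square)
    then have ts: "t = s * r" using s by simp
    then have "t\<^sup>2 = r\<^sup>2" using s by (simp add: power_mult_distrib)
    then have "y = 0" using n by simp
    then show False using z ts by (simp add: stereo_dom_def zt)
  qed
  define x where "x = stereo_map r s z"
  have x: "x = (r / d) *\<^sub>R y" by (simp add: x_def stereo_map_def zt d_def)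
  have yy: "y \<bullet> y = d * (r + s * t)"
  proof -
    have "d * (r + s * t) = r\<^sup>2 - s\<^sup>2 * t\<^sup>2" by (simp add: d_def power2_eq_square algebra_simps)
    then show ?thesis using n s by simp
  qed
  have xx: "x \<bullet> x = r\<^sup>2 * (r + s * t) / d"
    using \<open>d \<noteq> 0\<close> by (simp add: x yy power2_eq_square)
  have p: "x \<bullet> x + r\<^sup>2 = 2 * r ^ 3 / d"
    using \<open>d \<noteq> 0\<close> by (simp add: xx field_simps) (simp add: d_def algebra_simps power2_eq_square power3_eq_cube)
  have m: "x \<bullet> x - r\<^sup>2 = 2 * r\<^sup>2 * (s * t) / d"
    using \<open>d \<noteq> 0\<close> by (simp add: xx field_simps) (simp add: d_def algebra_simps power2_eq_square power3_eq_cube)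
  have "inverse (2 * r ^ 3 / d) * (2 * r\<^sup>2) * (r / d) = 1"
    using \<open>d \<noteq> 0\<close> r by (simp add: field_simps power2_eq_square power3_eq_cube)
  moreover have "inverse (2 * r ^ 3 / d) * (s * r * (2 * r\<^sup>2 * (s * t) / d)) = t"
  proof -
    have "inverse (2 * r ^ 3 / d) * (s * r * (2 * r\<^sup>2 * (s * t) / d)) = s\<^sup>2 * t"
      using \<open>d \<noteq> 0\<close> r by (simp add: field_simps power2_eq_square power3_eq_cube)
    then show ?thesis using s by simp
  qed
  ultimately show ?thesis
    unfolding x_def[symmetric] stereo_inv_def p m by (simp add: x zt)
qed

text \<open>The chart is onto the whole coordinate space, so \<open>inv_into\<close> agrees
  everywhere with the explicit formula; this makes the metric of \<open>round_sphere\<close>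
  computable.\<close>

lemma inv_into_stereo_map:
  assumes "0 < r" "s\<^sup>2 = 1" shows "inv_into (stereo_dom r s) (stereo_map r s) = stereo_inv r s"
proof
  fix x :: 'a
  have "inj_on (stereo_map r s) (stereo_dom r s :: ('a \<times> real) set)"
    by (metis assms inj_onI stereo_inv_map)
  then show "inv_into (stereo_dom r s) (stereo_map r s) x = stereo_inv r s x"
    using stereo_map_inv[OF assms, of x] inv_into_f_eq by metis
qed

lemma Ck_on_stereo_inv:
  assumes r: "0 < r" and S: "open S" "Ck_on k S c"
  shows "Ck_on k S (\<lambda>x. stereo_inv r s (c x))"
proof -
  have cc: "Ck_on k S (\<lambda>x. c x \<bullet> c x)"
    by (rule Ck_on_bounded_bilinear[OF S(1) bounded_bilinear_inner S(2) S(2)])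
  have "y \<bullet> y + r\<^sup>2 \<noteq> 0" for y :: 'b
    using r by (smt (verit) inner_ge_zero zero_less_power)
  then show ?thesis
    unfolding stereo_inv_def diff_conv_add_uminus
    by (intro Ck_on_bounded_bilinear[OF S(1) bounded_bilinear_scaleR] Ck_on_inverse[OF S(1)]
          Ck_on_add[OF S(1)] Ck_on_Pair[OF S(1)] cc Ck_on_const S(2)
          Ck_on_bounded_linear[OF S(1) bounded_linear_scaleR_right]
          Ck_on_bounded_linear[OF S(1) bounded_linear_mult_right])
qed

text \<open>The formula for \<open>stereo_map\<close> is differentiable on an open subset of the
  ambient space, so the chain rule for \<open>stereo_map\<close> after \<open>stereo_inv\<close>
  gives a left inverse of the derivative.\<close>

lemma dir_stereo_inv_inj:
  fixes x :: "'s::euclidean_space"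
  assumes r: "0 < r" and s: "s\<^sup>2 = 1" and w: "dir w (stereo_inv r s) x = 0"
  shows "w = 0"
proof -
  have "Ck_on 1 UNIV (\<lambda>x :: 's. stereo_inv r s x)"
    by (rule Ck_on_stereo_inv[OF r _ Ck_on_id]) simp
  then have d: "stereo_inv r s differentiable (at x)" by simp
  let ?z = "stereo_inv r s x" and ?O = "{z :: 's \<times> real. r - s * snd z \<noteq> 0}"
  have O: "open ?O" by (intro open_Collect_neq continuous_intros)
  have "Ck_on 1 ?O (\<lambda>z. (r * inverse (r + - s * snd z)) *\<^sub>R fst z)"
    by (intro Ck_on_bounded_bilinear[OF O bounded_bilinear_scaleR] Ck_on_inverse[OF O]
          Ck_on_add[OF O] Ck_on_const Ck_on_bounded_linear[OF O bounded_linear_mult_right]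
          Ck_on_bounded_linear[OF O bounded_linear_fst Ck_on_id]
          Ck_on_bounded_linear[OF O bounded_linear_snd Ck_on_id]) simp
  moreover have "(\<lambda>z. (r * inverse (r + - s * snd z)) *\<^sub>R fst z) = (stereo_map r s :: 's \<times> real \<Rightarrow> 's)"
    by (auto simp: stereo_map_def divide_inverse)
  ultimately have "Ck_on 1 ?O (stereo_map r s)" by simp
  then have "\<forall>z\<in>?O. (stereo_map r s :: 's \<times> real \<Rightarrow> 's) differentiable (at z)"
    unfolding One_nat_def Ck_on.simps by blast
  moreover have "?z \<in> ?O" using stereo_inv_denominator(2)[OF r s] by simp
  ultimately have dm: "stereo_map r s differentiable (at ?z)" by blast
  have "dir w (\<lambda>x. stereo_map r s (stereo_inv r s x)) x = 0"
    using dir_compose[OF d dm] w dir_zero[OF dm] by simp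
  then have "dir w (\<lambda>x. x) x = 0" by (simp add: stereo_map_inv(2)[OF r s])
  then show "w = 0" by (simp add: deriv_along_def)
qed

text \<open>A dimension count: the range of \<open>A\<close> has codimension one and
  \<open>P\<close> is orthogonal to it, so together they span. The part of \<open>n\<close>
  orthogonal to \<open>P\<close> is then orthogonal to everything.\<close>

lemma normal_to_sphere:
  fixes A :: "'s::euclidean_space \<Rightarrow> 's \<times> real"
  assumes A: "linear A" "\<And>w. A w = 0 \<Longrightarrow> w = 0"
    and P: "P \<noteq> 0" "\<And>w. A w \<bullet> P = 0" and n: "\<And>w. n \<bullet> A w = 0"
  shows "n = (n \<bullet> P / (P \<bullet> P)) *\<^sub>R P"
proof -
  define L where "L = (\<lambda>(w, t). A w + t *\<^sub>R P)"
  have L: "linear L"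
    by (rule linearI) (auto simp: L_def linear_add[OF A(1)] linear_cmul[OF A(1)] algebra_simps)
  have "p = 0" if "L p = 0" for p
  proof -
    obtain w t where p: "p = (w, t)" by force
    have "(A w + t *\<^sub>R P) \<bullet> P = 0" using that by (simp add: L_def p)
    then have "t = 0" using P by (simp add: inner_add_left)
    then show ?thesis using that A(2) by (simp add: L_def p zero_prod_def)
  qed
  then have "inj L" using L by (simp add: linear_injective_0)
  then have "surj L" using linear_injective_imp_surjective[OF L] by simp
  define n' where "n' = n - (n \<bullet> P / (P \<bullet> P)) *\<^sub>R P"
  obtain w t where "L (w, t) = n'" using \<open>surj L\<close> by (metis surjD surj_pair)
  then have "n' \<bullet> n' = n' \<bullet> (A w + t *\<^sub>R P)" by (simp add: L_def)
  also have "\<dots> = 0"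
    using P n by (simp add: n'_def inner_add_right inner_diff_left inner_commute[of P "A w"])
  finally show ?thesis by (simp add: n'_def)
qed

text \<open>The normal space is spanned by the position vector. The coefficient comes from
  differentiating the orthogonality of \<sigma> and its tangent vectors once more; \<open>g\<close>
  stands for the Christoffel term.\<close>

lemma sphere_second_fundamental_form:
  fixes \<sigma> :: "'s::euclidean_space \<Rightarrow> 's \<times> real"
  assumes C: "Ck_on 2 UNIV \<sigma>" and sph: "\<And>x. \<sigma> x \<bullet> \<sigma> x = r\<^sup>2" and r: "r \<noteq> 0"
    and inj: "\<And>w. dir w \<sigma> y = 0 \<Longrightarrow> w = 0"
    and n: "\<And>w. (dir a (dir b \<sigma>) y - dir g \<sigma> y) \<bullet> dir w \<sigma> y = 0"
  shows "dir a (dir b \<sigma>) y - dir g \<sigma> y = - ((dir a \<sigma> y \<bullet> dir b \<sigma> y) / r\<^sup>2) *\<^sub>R \<sigma> y"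
proof -
  have d1: "\<And>y. \<sigma> differentiable (at y)" and d2: "\<And>y v. dir v \<sigma> differentiable (at y)"
    using C by (auto simp: numeral_2_eq_2)
  have t: "dir w \<sigma> y \<bullet> \<sigma> y = 0" for w y
    using dir_inner[OF d1 d1, of w y] by (simp add: sph dir_const inner_commute)
  have "dir a (\<lambda>y. dir b \<sigma> y \<bullet> \<sigma> y) y = dir b \<sigma> y \<bullet> dir a \<sigma> y + dir a (dir b \<sigma>) y \<bullet> \<sigma> y"
    by (rule dir_inner[OF d2 d1])
  moreover have "dir a (\<lambda>y. dir b \<sigma> y \<bullet> \<sigma> y) y = 0" by (simp add: t dir_const)
  ultimately have ab: "dir a (dir b \<sigma>) y \<bullet> \<sigma> y = - (dir a \<sigma> y \<bullet> dir b \<sigma> y)"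
    by (simp add: inner_commute[of "dir b \<sigma> y" "dir a \<sigma> y"])
  have "\<sigma> y \<noteq> 0" using sph[of y] r by auto
  then show ?thesis
    using normal_to_sphere[OF linear_dir[OF d1] inj _ t n] ab
    by (simp add: inner_diff_left t sph)
qed

definition torus_inv ::
  "real \<Rightarrow> real \<Rightarrow> real \<times> real \<Rightarrow> 's::euclidean_space \<times> 't::euclidean_space \<Rightarrow> ('s \<times> real) \<times> ('t \<times> real)"
where
  "torus_inv r1 r2 k z = (stereo_inv r1 (fst k) (fst z), stereo_inv r2 (snd k) (snd z))"

lemma openin_stereo_dom: "openin (top_of_set (sphere 0 r)) (stereo_dom r s)"
  unfolding stereo_dom_def Diff_eq by (intro openin_open_Int open_Compl closed_singleton)

locale torus =
  fixes r1 r2 :: real and k :: "real \<times> real"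
    and T :: "(real \<times> real, ('s::euclidean_space \<times> real) \<times> ('t::euclidean_space \<times> real), 's \<times> 't) riem"
    and \<tau> :: "'s \<times> 't \<Rightarrow> ('s \<times> real) \<times> ('t \<times> real)"
  assumes r1: "0 < r1" and r2: "0 < r2"
    and T_def: "T = riem_product (round_sphere r1) (round_sphere r2)" and k: "k \<in> ind T"
    and \<tau>_def: "\<tau> = torus_inv r1 r2 k"
begin

lemma k_sq: "(fst k)\<^sup>2 = 1" "(snd k)\<^sup>2 = 1"
  using k by (auto simp: T_def riem_product_def warped_product_def round_sphere_def)

lemma smooth_spheres:
  "Ck_on n UNIV (stereo_inv r1 (fst k) :: 's \<Rightarrow> 's \<times> real)" "Ck_on n UNIV (stereo_inv r2 (snd k) :: 't \<Rightarrow> 't \<times> real)"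
  using Ck_on_stereo_inv[OF r1 open_UNIV Ck_on_id, of n "fst k"]
    Ck_on_stereo_inv[OF r2 open_UNIV Ck_on_id, of n "snd k"] by simp_all

lemma spheres_differentiable:
  "(stereo_inv r1 (fst k) :: 's \<Rightarrow> 's \<times> real) differentiable (at x)"
  "(stereo_inv r2 (snd k) :: 't \<Rightarrow> 't \<times> real) differentiable (at y)"
  "dir v (stereo_inv r1 (fst k) :: 's \<Rightarrow> 's \<times> real) differentiable (at x)"
  "dir w (stereo_inv r2 (snd k) :: 't \<Rightarrow> 't \<times> real) differentiable (at y)"
  using smooth_spheres[of 2] by (simp_all add: numeral_2_eq_2)

lemma Ck_on_chart_inverse: "open S \<Longrightarrow> Ck_on n S c \<Longrightarrow> Ck_on n S (\<lambda>x. \<tau> (c x))"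
  unfolding \<tau>_def torus_inv_def
  by (intro Ck_on_Pair Ck_on_stereo_inv r1 r2 Ck_on_bounded_linear[OF _ bounded_linear_fst]
      Ck_on_bounded_linear[OF _ bounded_linear_snd])

lemma dir_product:
  assumes "a differentiable (at (fst z))" "b differentiable (at (snd z))"
  shows "dir w (\<lambda>z. (a (fst z), b (snd z))) z = (dir (fst w) a (fst z), dir (snd w) b (snd z))"
  by (rule dir_eqI, rule has_derivative_Pair)
     (use has_derivative_dir[OF dir_fst(2)[OF assms(1)]] has_derivative_dir[OF dir_snd(2)[OF assms(2)]]
      in \<open>simp_all add: dir_fst(1)[OF assms(1)] dir_snd(1)[OF assms(2)]\<close>)

lemma dir_\<tau>:
  "dir w \<tau> z = (dir (fst w) (stereo_inv r1 (fst k)) (fst z), dir (snd w) (stereo_inv r2 (snd k)) (snd z))"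
  unfolding \<tau>_def torus_inv_def[abs_def] by (rule dir_product) (rule spheres_differentiable)+

lemma dir_dir_\<tau>:
  "dir v (dir w \<tau>) z = (dir (fst v) (dir (fst w) (stereo_inv r1 (fst k))) (fst z),
     dir (snd v) (dir (snd w) (stereo_inv r2 (snd k))) (snd z))"
  unfolding dir_\<tau>[abs_def] by (rule dir_product) (rule spheres_differentiable)+

lemma dir_\<tau>_inj: "dir w \<tau> z = 0 \<Longrightarrow> w = 0"
  using dir_stereo_inv_inj[OF r1 k_sq(1), of "fst w" "fst z"] dir_stereo_inv_inj[OF r2 k_sq(2), of "snd w" "snd z"]
  by (simp add: dir_\<tau> zero_prod_def prod_eq_iff)

lemma metr_torus: "metr T k y a b = dir a \<tau> y \<bullet> dir b \<tau> y"
  unfolding dir_\<tau> using r1 r2 k_sq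
  by (simp add: T_def riem_product_def warped_product_def round_sphere_def case_prod_beta
      inv_into_stereo_map deriv_along_def)

lemma openin_cdom_torus: "openin (mtop T) (cdom T k)"
  by (simp add: T_def riem_product_def warped_product_def round_sphere_def case_prod_beta
      openin_Times openin_stereo_dom)

text \<open>The expression is the Gauss form of the curvature of a product of spheres. The normals
  of the two factors lie in orthogonal summands, so it is the sum over both factors of a Gram
  determinant divided by the squared radius.\<close>

lemma torus_gauss:
  assumes \<Gamma>: "\<And>a b w. dir (\<Gamma> a b) \<tau> y \<bullet> dir w \<tau> y = dir a (dir b \<tau>) y \<bullet> dir w \<tau> y"
  defines "II \<equiv> \<lambda>a b. dir a (dir b \<tau>) y - dir (\<Gamma> a b) \<tau> y"
  shows "0 \<le> II a a \<bullet> II b b - II a b \<bullet> II a b"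
proof -
  define \<sigma>1 where "\<sigma>1 = (stereo_inv r1 (fst k) :: 's \<Rightarrow> 's \<times> real)"
  define \<sigma>2 where "\<sigma>2 = (stereo_inv r2 (snd k) :: 't \<Rightarrow> 't \<times> real)"
  have orth: "II a b \<bullet> dir w \<tau> y = 0" for a b w
    using \<Gamma> by (simp add: II_def inner_diff_left)
  have sph: "\<sigma>1 x \<bullet> \<sigma>1 x = r1\<^sup>2" "\<sigma>2 x' \<bullet> \<sigma>2 x' = r2\<^sup>2" for x x'
    using stereo_inv_on_sphere r1 r2 k_sq by (simp_all add: \<sigma>1_def \<sigma>2_def)
  have smooth: "Ck_on 2 UNIV \<sigma>1" "Ck_on 2 UNIV \<sigma>2"
    unfolding \<sigma>1_def \<sigma>2_def by (rule smooth_spheres)+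
  have inj: "dir w \<sigma>1 x = 0 \<Longrightarrow> w = 0" "dir w' \<sigma>2 x' = 0 \<Longrightarrow> w' = 0" for w x w' x'
    using dir_stereo_inv_inj[OF r1 k_sq(1)] dir_stereo_inv_inj[OF r2 k_sq(2)] by (simp_all add: \<sigma>1_def \<sigma>2_def)
  have II: "II a b = (- ((dir (fst a) \<sigma>1 (fst y) \<bullet> dir (fst b) \<sigma>1 (fst y)) / r1\<^sup>2) *\<^sub>R \<sigma>1 (fst y),
      - ((dir (snd a) \<sigma>2 (snd y) \<bullet> dir (snd b) \<sigma>2 (snd y)) / r2\<^sup>2) *\<^sub>R \<sigma>2 (snd y))" for a b
  proof -
    have II_pair: "II a b = (dir (fst a) (dir (fst b) \<sigma>1) (fst y) - dir (fst (\<Gamma> a b)) \<sigma>1 (fst y),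
       dir (snd a) (dir (snd b) \<sigma>2) (snd y) - dir (snd (\<Gamma> a b)) \<sigma>2 (snd y))"
      by (simp add: II_def dir_\<tau> dir_dir_\<tau> \<sigma>1_def \<sigma>2_def)
    \<comment> \<open>Testing normality against vectors tangent to a single factor splits it into
      normality for each sphere.\<close>
    have n1: "(dir (fst a) (dir (fst b) \<sigma>1) (fst y) - dir (fst (\<Gamma> a b)) \<sigma>1 (fst y)) \<bullet> dir w \<sigma>1 (fst y) = 0" for w
      using orth[of a b "(w, 0)"] unfolding II_pair
      by (simp add: dir_\<tau> \<sigma>1_def[symmetric] dir_zero[OF spheres_differentiable(2)])
    have n2: "(dir (snd a) (dir (snd b) \<sigma>2) (snd y) - dir (snd (\<Gamma> a b)) \<sigma>2 (snd y)) \<bullet> dir w \<sigma>2 (snd y) = 0" for w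
      using orth[of a b "(0, w)"] unfolding II_pair
      by (simp add: dir_\<tau> \<sigma>2_def[symmetric] dir_zero[OF spheres_differentiable(1)])
    show ?thesis
      unfolding II_pair
      using sphere_second_fundamental_form[OF smooth(1) sph(1) _ inj(1) n1]
        sphere_second_fundamental_form[OF smooth(2) sph(2) _ inj(2) n2] r1 r2 by simp
  qed
  have cancel: "- (s / r\<^sup>2) * (- (t / r\<^sup>2) * r\<^sup>2) = s * t / r\<^sup>2" if "0 < r" for s t r :: real
    using that by (simp add: power2_eq_square)
  have prod: "II a b \<bullet> II c d
      = (dir (fst a) \<sigma>1 (fst y) \<bullet> dir (fst b) \<sigma>1 (fst y)) * (dir (fst c) \<sigma>1 (fst y) \<bullet> dir (fst d) \<sigma>1 (fst y)) / r1\<^sup>2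
      + (dir (snd a) \<sigma>2 (snd y) \<bullet> dir (snd b) \<sigma>2 (snd y)) * (dir (snd c) \<sigma>2 (snd y) \<bullet> dir (snd d) \<sigma>2 (snd y)) / r2\<^sup>2"
    for a b c d
    unfolding II inner_Pair inner_scaleR_left inner_scaleR_right sph
    by (simp only: cancel[OF r1] cancel[OF r2] mult.assoc) (simp only: mult.commute)
  have cs: "0 \<le> ((u \<bullet> u) * (v \<bullet> v) - (u \<bullet> v) * (u \<bullet> v)) / r\<^sup>2" for u v :: "'w::real_inner" and r :: real
    using Cauchy_Schwarz_ineq[of u v] by (simp add: power2_eq_square)
  show ?thesis
    unfolding prod
    using cs[of "dir (fst a) \<sigma>1 (fst y)" "dir (fst b) \<sigma>1 (fst y)" r1]
      cs[of "dir (snd a) \<sigma>2 (snd y)" "dir (snd b) \<sigma>2 (snd y)" r2]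
    by (simp add: diff_divide_distrib mult.commute)
qed

end

section \<open>Charts of the warped product\<close>

lemma inv_into_product:
  assumes "inj_on f A" "inj_on g B" "x \<in> f ` A" "y \<in> g ` B"
  shows "inv_into (A \<times> B) (\<lambda>(p, q). (f p, g q)) (x, y) = (inv_into A f x, inv_into B g y)"
  using assms by (intro inv_into_f_eq) (auto simp: inj_on_def f_inv_into_f inv_into_into)

lemma smooth_manifold_chart:
  assumes "smooth_manifold M" "i \<in> ind M"
  shows "openin (mtop M) (cdom M i)" "open (cmap M i ` cdom M i)" "inj_on (cmap M i) (cdom M i)"
    and "continuous_map (top_of_set (cmap M i ` cdom M i)) (mtop M) (param M i)"
proof -
  have o: "openin (mtop M) (cdom M i)" "open (cmap M i ` cdom M i)"
    and hom: "homeomorphic_map (subtopology (mtop M) (cdom M i)) (top_of_set (cmap M i ` cdom M i)) (cmap M i)"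
    using assms unfolding smooth_manifold_def by blast+
  have top: "topspace (subtopology (mtop M) (cdom M i)) = cdom M i"
    using openin_subset[OF o(1)] by auto
  have inj: "inj_on (cmap M i) (cdom M i)"
    using homeomorphic_imp_injective_map[OF hom] by (simp only: top)
  obtain g where g: "homeomorphic_maps (subtopology (mtop M) (cdom M i)) (top_of_set (cmap M i ` cdom M i)) (cmap M i) g"
    using hom by (auto simp: homeomorphic_map_maps)
  have "continuous_map (top_of_set (cmap M i ` cdom M i)) (subtopology (mtop M) (cdom M i)) (param M i)"
  \<comment> \<open>The homeomorphism supplies some continuous inverse \<open>g\<close>; injectivity
    of the chart identifies it with \<open>param\<close> on the chart image.\<close>
  proof (rule continuous_map_eq)
    show "continuous_map (top_of_set (cmap M i ` cdom M i)) (subtopology (mtop M) (cdom M i)) g"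
      using g by (simp add: homeomorphic_maps_def)
    fix x assume "x \<in> topspace (top_of_set (cmap M i ` cdom M i))"
    then obtain p where p: "p \<in> cdom M i" "x = cmap M i p" by auto
    then have "g x = p" using g top unfolding homeomorphic_maps_def by metis
    then show "g x = param M i x" using p inj by (simp add: param_def)
  qed
  then show "continuous_map (top_of_set (cmap M i ` cdom M i)) (mtop M) (param M i)"
    by (simp add: continuous_map_in_subtopology)
  show "openin (mtop M) (cdom M i)" "open (cmap M i ` cdom M i)" "inj_on (cmap M i) (cdom M i)"
    by (fact o inj)+
qed

lemma param_in_cdom: "x \<in> cmap M i ` cdom M i \<Longrightarrow> param M i x \<in> cdom M i"
  and cmap_param: "x \<in> cmap M i ` cdom M i \<Longrightarrow> cmap M i (param M i x) = x"
  by (auto simp: param_def inv_into_into f_inv_into_f)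

lemma riemannian_manifold_metr:
  assumes "riemannian_manifold M" "i \<in> ind M" "x \<in> cmap M i ` cdom M i"
  shows "bilinear (metr M i x)" and "u \<noteq> 0 \<Longrightarrow> 0 < metr M i x u u"
  using assms by (auto simp: riemannian_manifold_def)

locale warped_chart =
  fixes B :: "('i, 'a, 'b::euclidean_space) riem" and F :: "('j, 'c, 'd::euclidean_space) riem"
    and f :: "'a \<Rightarrow> real" and M :: "('i \<times> 'j, 'a \<times> 'c, 'b \<times> 'd) riem" and i j
    and \<rho> VB VF
  assumes B: "riemannian_manifold B" and F: "riemannian_manifold F" and f: "smooth_function B f"
    and M_def: "M = warped_product B f F" and i: "i \<in> ind B" and j: "j \<in> ind F"
    and \<rho>_def: "\<rho> = f \<circ> param B i"
    and VB_def: "VB = cmap B i ` cdom B i" and VF_def: "VF = cmap F j ` cdom F j"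
begin

lemma smooth_factors: "smooth_manifold B" "smooth_manifold F"
  using B F by (simp_all add: riemannian_manifold_def)

lemmas B_chart = smooth_manifold_chart[OF smooth_factors(1) i, folded VB_def]
lemmas F_chart = smooth_manifold_chart[OF smooth_factors(2) j, folded VF_def]

lemma cdom_M: "cdom M (i, j) = cdom B i \<times> cdom F j"
  and cmap_M: "cmap M (i, j) = (\<lambda>(p, q). (cmap B i p, cmap F j q))"
  and mtop_M: "mtop M = prod_topology (mtop B) (mtop F)"
  by (simp_all add: M_def warped_product_def)

lemma image_M: "cmap M (i, j) ` cdom M (i, j) = VB \<times> VF"
  by (auto simp: cdom_M cmap_M VB_def VF_def)

lemma open_chart: "open (VB \<times> VF)"
  by (intro open_Times B_chart F_chart)

lemma inj_chart: "inj_on (cmap M (i, j)) (cdom M (i, j))"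
  using B_chart(3) F_chart(3) by (auto simp: cdom_M cmap_M inj_on_def)

lemma param_M: "z \<in> VB \<times> VF \<Longrightarrow> param M (i, j) z = (param B i (fst z), param F j (snd z))"
  using inv_into_product[OF B_chart(3) F_chart(3), of "fst z" "snd z"]
  by (auto simp: param_def cdom_M cmap_M VB_def VF_def)

lemma metr_M: "metr M (i, j) z u v
    = metr B i (fst z) (fst u) (fst v) + (\<rho> (fst z))\<^sup>2 * metr F j (snd z) (snd u) (snd v)"
  by (simp add: M_def warped_product_def \<rho>_def case_prod_beta)

lemma metr_B_bilinear: "x \<in> VB \<Longrightarrow> bilinear (metr B i x)"
  and metr_F_bilinear: "y \<in> VF \<Longrightarrow> bilinear (metr F j y)"
  and metr_F_pos: "y \<in> VF \<Longrightarrow> v \<noteq> 0 \<Longrightarrow> 0 < metr F j y v v"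
  using riemannian_manifold_metr[OF B i] riemannian_manifold_metr[OF F j] unfolding VB_def VF_def by blast+

lemma metr_B_differentiable: "x \<in> VB \<Longrightarrow> (\<lambda>x. metr B i x u v) differentiable (at x)"
  and metr_F_differentiable: "y \<in> VF \<Longrightarrow> (\<lambda>y. metr F j y u' v') differentiable (at y)"
proof -
  have "Ck_on (Suc 0) VB (\<lambda>x. metr B i x u v)" "Ck_on (Suc 0) VF (\<lambda>y. metr F j y u' v')"
    using B F i j unfolding riemannian_manifold_def smooth_on_def VB_def VF_def by blast+
  then show "x \<in> VB \<Longrightarrow> (\<lambda>x. metr B i x u v) differentiable (at x)"
    "y \<in> VF \<Longrightarrow> (\<lambda>y. metr F j y u' v') differentiable (at y)" by simp_all
qed

lemma \<rho>_differentiable: "x \<in> VB \<Longrightarrow> \<rho> differentiable (at x)"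
  and dir_\<rho>_differentiable: "x \<in> VB \<Longrightarrow> dir u \<rho> differentiable (at x)"
proof -
  have "Ck_on 2 VB \<rho>" using f i unfolding smooth_function_def smooth_on_def VB_def \<rho>_def by blast
  then show "x \<in> VB \<Longrightarrow> \<rho> differentiable (at x)" "x \<in> VB \<Longrightarrow> dir u \<rho> differentiable (at x)"
    by (simp_all add: numeral_2_eq_2)
qed

text \<open>In coordinates the set is the preimage of \<open>D\<close> under a continuous map on the
  open chart image. Openness is what allows identities on it to be differentiated.\<close>

lemma open_chart_preimage:
  assumes \<phi>: "continuous_map (mtop M) X \<phi>" and D: "openin X D"
  shows "open (cmap M (i, j) ` (cdom M (i, j) \<inter> \<phi> -` D))"
proof -
  let ?X = "top_of_set (VB \<times> VF)"
  have "continuous_map ?X (top_of_set VB) fst" "continuous_map ?X (top_of_set VF) snd"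
    by (auto intro: continuous_on_fst continuous_on_snd continuous_on_id)
  then have "continuous_map ?X (mtop M) (\<lambda>z. (param B i (fst z), param F j (snd z)))"
    unfolding mtop_M continuous_map_pairwise o_def
    using continuous_map_compose[OF _ B_chart(4), of ?X fst] continuous_map_compose[OF _ F_chart(4), of ?X snd]
    by (simp add: o_def del: continuous_map_subtopology_eu)
  then have "continuous_map ?X (mtop M) (param M (i, j))"
    by (rule continuous_map_eq) (simp add: param_M)
  from openin_continuous_map_preimage[OF continuous_map_compose[OF this \<phi>] D]
  have "openin ?X {z \<in> VB \<times> VF. \<phi> (param M (i, j) z) \<in> D}" by simp
  then have "open {z \<in> VB \<times> VF. \<phi> (param M (i, j) z) \<in> D}"
    using open_chart openin_open_trans by blast
  moreover have "cmap M (i, j) ` (cdom M (i, j) \<inter> \<phi> -` D) = {z \<in> VB \<times> VF. \<phi> (param M (i, j) z) \<in> D}"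
  proof (intro set_eqI iffI)
    fix z assume "z \<in> cmap M (i, j) ` (cdom M (i, j) \<inter> \<phi> -` D)"
    then show "z \<in> {z \<in> VB \<times> VF. \<phi> (param M (i, j) z) \<in> D}"
      using image_M inj_chart by (auto simp: param_def)
  next
    fix z assume z: "z \<in> {z \<in> VB \<times> VF. \<phi> (param M (i, j) z) \<in> D}"
    then have "z \<in> cmap M (i, j) ` cdom M (i, j)" by (simp add: image_M)
    then show "z \<in> cmap M (i, j) ` (cdom M (i, j) \<inter> \<phi> -` D)"
      using z param_in_cdom[of z M "(i, j)"] cmap_param[of z M "(i, j)"] by (metis (mono_tags) IntI image_eqI mem_Collect_eq vimageI)
  qed
  ultimately show ?thesis by simp
qed

text \<open>The derivative of \<open>E a\<close> along itself occurs in both terms of the Laplacian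
  and cancels. Since \<open>f\<close> does not depend on the fibre, only the base component of the
  Christoffel term survives.\<close>

lemma warped_laplacian_eq:
  assumes p: "p \<in> cdom B i" and q: "q \<in> cdom F j"
    and E: "\<And>a. a < DIM('b) \<Longrightarrow> E a differentiable (at (cmap B i p))"
  shows "warped_laplacian B f F (i, j) E (p, q) = (\<Sum>a<DIM('b).
    dir (fst (christoffel M (i, j) (cmap B i p, cmap F j q) (E a (cmap B i p), 0) (E a (cmap B i p), 0))) \<rho> (cmap B i p)
    - dir (E a (cmap B i p)) (dir (E a (cmap B i p)) \<rho>) (cmap B i p))"
proof -
  define x where "x = cmap B i p"
  define z where "z = (x, cmap F j q)"
  define u where "u = (f \<circ> fst) \<circ> param M (i, j)"
  have z: "z \<in> VB \<times> VF" "x \<in> VB" using p q by (auto simp: z_def x_def VB_def VF_def)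
  have u: "u z = \<rho> (fst z)" if "z \<in> VB \<times> VF" for z
    using param_M[OF that] by (simp add: u_def \<rho>_def)
  have dir_u: "dir w u z = dir (fst w) \<rho> (fst z)" if "z \<in> VB \<times> VF" for w z
  proof -
    have "dir w u z = dir w (\<lambda>z. \<rho> (fst z)) z"
      by (rule dir_cong[OF open_chart that u])
    then show ?thesis using that by (auto simp: dir_fst(1)[OF \<rho>_differentiable])
  qed
  have summand: "deriv_along (nabla M (i, j) (lift_field X) (lift_field X)) u z
      - deriv_along (lift_field X) (deriv_along (lift_field X) u) z
    = dir (fst (christoffel M (i, j) z (X x, 0) (X x, 0))) \<rho> x - dir (X x) (dir (X x) \<rho>) x"
    if X: "X differentiable (at x)" for X :: "'b \<Rightarrow> 'b"
  proof -
    let ?e = "lift_field X :: 'b \<times> 'd \<Rightarrow> 'b \<times> 'd"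
    have ez: "?e z = (X x, 0)" by (simp add: lift_field_def z_def)
    have "((\<lambda>z :: 'b \<times> 'd. (X (fst z), 0 :: 'd)) has_derivative (\<lambda>w. (dir (fst w) X (fst z), 0))) (at z)"
      using has_derivative_compose[OF has_derivative_fst[OF has_derivative_ident], of X _ z UNIV] has_derivative_dir[OF X]
      by (intro has_derivative_Pair has_derivative_const) (simp add: z_def)
    then have "dir (?e z) ?e z = (dir (X x) X x, 0)"
      unfolding ez lift_field_def case_prod_beta by (simp add: dir_eqI z_def)
    then have n: "nabla M (i, j) ?e ?e z = (dir (X x) X x, 0) + christoffel M (i, j) z (X x, 0) (X x, 0)"
      by (simp add: nabla_def deriv_along_eq_dir[of ?e] ez)
    have 1: "deriv_along (nabla M (i, j) ?e ?e) u z
        = dir (dir (X x) X x) \<rho> x + dir (fst (christoffel M (i, j) z (X x, 0) (X x, 0))) \<rho> x"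
      unfolding deriv_along_eq_dir[of "nabla M (i, j) ?e ?e"] n
      using z dir_add[OF \<rho>_differentiable[OF z(2)]] by (simp add: dir_u) (simp add: z_def)
    have "deriv_along ?e (deriv_along ?e u) z = dir (X x, 0) (\<lambda>z. dir (X (fst z)) \<rho> (fst z)) z"
      unfolding deriv_along_eq_dir[of ?e "deriv_along ?e u"] ez
      by (rule dir_cong[OF open_chart z(1)], unfold deriv_along_eq_dir[of ?e u])
         (simp add: dir_u lift_field_def case_prod_beta)
    also have "\<dots> = dir (dir (X x, 0) fst z) (dir (X (fst z)) \<rho>) (fst z)
        + dir (dir (X x, 0) (\<lambda>z. X (fst z)) z) \<rho> (fst z)"
    proof (rule dir_moving_direction[OF open_chart z(1) B_chart(2)])
      show "fst ` (VB \<times> VF) \<subseteq> VB" by auto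
      show "fst differentiable at z"
        by (rule differentiableI[OF has_derivative_fst[OF has_derivative_ident]])
      show "(\<lambda>z. X (fst z)) differentiable at z"
        using X by (intro dir_fst(2)) (simp add: z_def)
    qed (use z in \<open>auto simp: z_def \<rho>_differentiable dir_\<rho>_differentiable\<close>)
    also have "dir (X x, 0) fst z = X x"
      by (rule trans[OF dir_eqI[OF has_derivative_fst[OF has_derivative_ident]]]) simp
    also have "dir (X x, 0) (\<lambda>z. X (fst z)) z = dir (X x) X x"
      using dir_fst(1)[of X z "(X x, 0)"] X by (simp add: z_def)
    finally have 2: "deriv_along ?e (deriv_along ?e u) z
        = dir (X x) (dir (X x) \<rho>) x + dir (dir (X x) X x) \<rho> x" by (simp add: z_def)
    show ?thesis unfolding 1 2 by simp
  qed
  have "cmap M (i, j) (p, q) = z" by (simp add: cmap_M z_def x_def)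
  then have "warped_laplacian B f F (i, j) E (p, q)
      = (\<Sum>a<DIM('b). deriv_along (nabla M (i, j) (lift_field (E a)) (lift_field (E a))) u z
          - deriv_along (lift_field (E a)) (deriv_along (lift_field (E a)) u) z)"
    by (simp add: warped_laplacian_def Let_def M_def[symmetric] u_def)
  also have "\<dots> = (\<Sum>a<DIM('b). dir (fst (christoffel M (i, j) z (E a x, 0) (E a x, 0))) \<rho> x
      - dir (E a x) (dir (E a x) \<rho>) x)"
    using E by (intro sum.cong refl summand) (simp add: x_def)
  finally show ?thesis by (simp add: x_def z_def)
qed

end

section \<open>The inequality\<close>

theorem corollary4p8:
  fixes B :: "('i, 'a, 'b::euclidean_space) riem"
    and F :: "('j, 'c, 'd::euclidean_space) riem"
    and f :: "'a \<Rightarrow> real"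
    and \<phi> :: "'a \<times> 'c \<Rightarrow> ('s::euclidean_space \<times> real) \<times> ('t::euclidean_space \<times> real)"
    and T :: "(real \<times> real, ('s \<times> real) \<times> ('t \<times> real), 's \<times> 't) riem"
    and n1 n2 n m1 m2 m :: nat
  assumes "riemannian_manifold B" and "riemannian_manifold F"
    and "n1 = DIM('b)" and "n2 = DIM('d)" and "n = n1 + n2"
    and "smooth_function B f" and "\<forall>p \<in> topspace (mtop B). f p > 0"
    and M_def: "M = warped_product B f F"
    and "m1 = DIM('s)" and "m2 = DIM('t)" and "m = m1 + m2"
    and "2 \<le> m1" and "real m1 \<le> real m / 2" and "4 \<le> m"
    and T_def: "T = clifford_torus"
    and "isometric_immersion M T \<phi>"
  shows "\<forall>p \<in> topspace (mtop B). \<forall>q \<in> topspace (mtop F).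
           \<forall>i \<in> ind B. \<forall>j \<in> ind F. \<forall>k \<in> ind T. \<forall>E e.
             p \<in> cdom B i \<longrightarrow> q \<in> cdom F j \<longrightarrow> \<phi> (p, q) \<in> cdom T k \<longrightarrow>
             orthonormal_frame B i p E \<longrightarrow> orthonormal_frame M (i, j) (p, q) e \<longrightarrow>
             warped_laplacian B f F (i, j) E (p, q) / f p \<ge>
               real n1 * (real n)\<^sup>2 / (2 * (real n - 1)) * mean_curvature_sq M T \<phi> (i, j) k e (p, q)
               - real n1 / 2 * second_ff_norm_sq M T \<phi> (i, j) k e (p, q)"
proof (intro ballI allI impI)
  fix p q i j k E e
  assume p_top: "p \<in> topspace (mtop B)" and i: "i \<in> ind B" and j: "j \<in> ind F" and k: "k \<in> ind T"
    and p: "p \<in> cdom B i" and q: "q \<in> cdom F j" and \<phi>pq: "\<phi> (p, q) \<in> cdom T k"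
    and E: "orthonormal_frame B i p E" and e: "orthonormal_frame M (i, j) (p, q) e"
  define \<rho> where "\<rho> = f \<circ> param B i"
  define VB where "VB = cmap B i ` cdom B i"
  define VF where "VF = cmap F j ` cdom F j"
  interpret warped_chart B F f M i j \<rho> VB VF
    by unfold_locales (fact assms(1) assms(2) assms(6) M_def i j \<rho>_def VB_def VF_def)+
  define r1 where "r1 = sqrt (real DIM('s) / real (DIM('s) + DIM('t)))"
  define r2 where "r2 = sqrt (real DIM('t) / real (DIM('s) + DIM('t)))"
  define \<tau> where "\<tau> = (torus_inv r1 r2 k :: 's \<times> 't \<Rightarrow> ('s \<times> real) \<times> ('t \<times> real))"
  interpret torus r1 r2 k T \<tau>
  proof
    show "0 < r1" "0 < r2" unfolding r1_def r2_def
      by (intro real_sqrt_gt_zero divide_pos_pos; simp add: add_pos_pos)+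
    show "T = riem_product (round_sphere r1) (round_sphere r2)"
      unfolding T_def clifford_torus_def r1_def r2_def ..
  qed (fact k \<tau>_def)+

  \<comment> \<open>The immersion in coordinates and its composition with the torus in Euclidean
    space\<close>
  define c where "c = coord_rep M T \<phi> (i, j) k"
  define U where "U = cmap M (i, j) ` (cdom M (i, j) \<inter> \<phi> -` cdom T k)"
  define z where "z = (cmap B i p, cmap F j q)"
  define \<psi> where "\<psi> = (\<lambda>y. \<tau> (c y))"
  have iM: "(i, j) \<in> ind M" using i j by (simp add: M_def warped_product_def)
  have \<phi>: "smooth_map M T \<phi>" using assms by (simp add: isometric_immersion_def)
  have U: "open U" unfolding U_def
    by (rule open_chart_preimage[OF _ openin_cdom_torus]) (use \<phi> in \<open>simp add: smooth_map_def\<close>)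
  have zM: "cmap M (i, j) (p, q) = z" by (simp add: cmap_M z_def)
  have z: "z \<in> U" using p q \<phi>pq zM unfolding U_def cdom_M by blast
  have U_chart: "fst y \<in> VB" "snd y \<in> VF" if "y \<in> U" for y
  proof -
    have "U \<subseteq> VB \<times> VF" unfolding U_def image_M[symmetric] by blast
    then show "fst y \<in> VB" "snd y \<in> VF" using that by auto
  qed
  have fst_z: "fst z = cmap B i p" and snd_z: "snd z = cmap F j q" by (simp_all add: z_def)
  have "Ck_on 3 U c"
    using \<phi> iM k unfolding smooth_map_def smooth_on_def U_def c_def by blast
  then have cC: "Ck_on 3 U c" and cC2: "Ck_on 2 U c"
    using Ck_on_SucD[of 2 U c] by (simp_all add: eval_nat_numeral del: Ck_on.simps)
  have c1: "y \<in> U \<Longrightarrow> c differentiable (at y)" and c2: "y \<in> U \<Longrightarrow> dir v c differentiable (at y)" for y v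
    by (simp_all add: Ck_on_2D[OF cC2])
  have \<psi>C: "Ck_on 3 U \<psi>" unfolding \<psi>_def by (rule Ck_on_chart_inverse[OF U cC])
  then have \<psi>C2: "Ck_on 2 U \<psi>"
    using Ck_on_SucD[of 2 U \<psi>] by (simp add: eval_nat_numeral del: Ck_on.simps)
  have \<tau>C: "Ck_on 2 UNIV \<tau>" using Ck_on_chart_inverse[OF open_UNIV Ck_on_id] by simp
  have \<tau>1: "\<tau> differentiable (at y)" and \<tau>2: "dir v \<tau> differentiable (at y)" for y v
    by (simp_all add: Ck_on_2D[OF \<tau>C])
  have \<psi>_dir: "dir v \<psi> y = dir (dir v c y) \<tau> (c y)" if "y \<in> U" for v y
    unfolding \<psi>_def by (rule dir_compose[OF c1[OF that] \<tau>1])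
  have immersion: "inj (\<lambda>u. dir u c y)"
    "metr M (i, j) y u v = metr T k (c y) (dir u c y) (dir v c y)" if "y \<in> U" for y u v
    using assms(16) iM k that
    unfolding isometric_immersion_def Let_def U_def c_def deriv_along_def by blast+
  have iso: "metr M (i, j) y u v = dir u \<psi> y \<bullet> dir v \<psi> y" if y: "y \<in> U" for y u v
    unfolding immersion(2)[OF y] metr_torus \<psi>_dir[OF y] ..
  have inj: "u = 0" if "dir u \<psi> z = 0" for u
  proof -
    have "dir u c z = dir 0 c z"
      using that dir_\<tau>_inj by (simp add: \<psi>_dir[OF z] dir_zero[OF c1[OF z]])
    then show ?thesis by (rule injD[OF immersion(1)[OF z]])
  qed

  \<comment> \<open>Splitting the second fundamental form\<close>
  define \<Gamma> where "\<Gamma> = christoffel M (i, j) z"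
  define \<Delta> where "\<Delta> = christoffel T k (c z)"
  note \<Gamma> = christoffel_immersion[OF U z \<psi>C2 iso inj, folded \<Gamma>_def]
  have \<tau>_inj: "w = 0" if "dir w \<tau> (c z) = 0" for w by (rule dir_\<tau>_inj[OF that])
  note \<Delta> = christoffel_immersion[OF open_UNIV UNIV_I[of "c z"] \<tau>C metr_torus \<tau>_inj, folded \<Delta>_def]

  \<comment> \<open>\<open>hh\<close> is the second fundamental form of \<phi> at \<open>z\<close>
    in torus coordinates, \<open>h\<close> its image in the ambient Euclidean space. The
    differential of \<tau> is isometric, so \<open>h\<close> carries the same norms.\<close>
  define hh where "hh = (\<lambda>u v. dir u (dir v c) z + \<Delta> (dir u c z) (dir v c z) - dir (\<Gamma> u v) c z)"
  define h where "h = (\<lambda>u v. dir (hh u v) \<tau> (c z))"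
  define II where "II = (\<lambda>a b. dir a (dir b \<tau>) (c z) - dir (\<Delta> a b) \<tau> (c z))"
  define H where "H = (\<lambda>u v. dir u (dir v \<psi>) z - dir (\<Gamma> u v) \<psi> z)"
  have H_split: "H u v = h u v + II (dir u c z) (dir v c z)" for u v
  proof -
    have "dir u (dir v \<psi>) z = dir u (\<lambda>y. dir (dir v c y) \<tau> (c y)) z"
      by (rule dir_cong[OF U z \<psi>_dir])
    also have "\<dots> = dir (dir u c z) (dir (dir v c z) \<tau>) (c z) + dir (dir u (dir v c) z) \<tau> (c z)"
      by (rule dir_moving_direction[OF U z open_UNIV]) (use \<tau>1 \<tau>2 c1[OF z] c2[OF z] in auto)
    finally show ?thesis
      unfolding H_def h_def II_def hh_def
      by (simp add: \<psi>_dir[OF z] linear_add[OF linear_dir[OF \<tau>1]] linear_diff[OF linear_dir[OF \<tau>1]])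
  qed
  have II_normal: "II a b \<bullet> dir w \<tau> (c z) = 0" for a b w
    using \<Delta>(3) by (simp add: II_def inner_diff_left)
  have gauss: "h u u \<bullet> h v v - h u v \<bullet> h u v \<le> H u u \<bullet> H v v - H u v \<bullet> H u v" for u v
  proof -
    \<comment> \<open>\<open>h\<close> is tangent to the torus and \<open>II\<close> is normal to
      it, so no cross terms arise.\<close>
    have "II a b \<bullet> h w w' = 0" "h w w' \<bullet> II a b = 0" for a b w w'
      using II_normal by (simp_all add: h_def inner_commute)
    moreover have "0 \<le> II (dir u c z) (dir u c z) \<bullet> II (dir v c z) (dir v c z)
        - II (dir u c z) (dir v c z) \<bullet> II (dir u c z) (dir v c z)"
      unfolding II_def by (rule torus_gauss) (rule \<Delta>(3))
    ultimately show ?thesis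
      unfolding H_split by (simp add: inner_add_left inner_add_right)
  qed
  have hh_sym: "hh u v = hh v u" for u v
    unfolding hh_def using dir_commute[OF U z cC2, of u v] \<Delta>(2) \<Gamma>(2) by metis
  have hh_linear: "linear (\<lambda>u. hh u v)" for v
    unfolding hh_def
    by (rule linearI)
       (simp_all add: dir_add[OF c2[OF z]] dir_scaleR[OF c2[OF z]] dir_add[OF c1[OF z]] dir_scaleR[OF c1[OF z]]
         bilinear_ladd[OF \<Delta>(1)] bilinear_lmul[OF \<Delta>(1)] bilinear_ladd[OF \<Gamma>(1)] bilinear_lmul[OF \<Gamma>(1)]
         algebra_simps)
  have "hh v = (\<lambda>u. hh u v)" for v by (rule ext) (rule hh_sym)
  then have hh_bilinear: "bilinear hh"
    unfolding bilinear_def using hh_linear by metis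
  have h_bilinear: "bilinear h"
    unfolding bilinear_def h_def
    by (intro allI conjI linearI)
       (simp_all add: dir_add[OF \<tau>1] dir_scaleR[OF \<tau>1] bilinear_ladd[OF hh_bilinear] bilinear_radd[OF hh_bilinear]
         bilinear_lmul[OF hh_bilinear] bilinear_rmul[OF hh_bilinear])
  have h_sym: "h u v = h v u" for u v unfolding h_def hh_sym[of u v] ..

  \<comment> \<open>Mean curvature and squared norm in the given frame\<close>
  obtain W where W: "open W" "z \<in> W" "\<And>a. a < DIM('b \<times> 'd) \<Longrightarrow> smooth_on W (e a)"
    "\<And>x a b. x \<in> W \<Longrightarrow> a < DIM('b \<times> 'd) \<Longrightarrow> b < DIM('b \<times> 'd) \<Longrightarrow>
      metr M (i, j) x (e a x) (e b x) = (if a = b then 1 else 0)"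
    using e unfolding orthonormal_frame_def zM by metis
  obtain WB where WB: "cmap B i p \<in> WB" "\<And>a. a < DIM('b) \<Longrightarrow> smooth_on WB (E a)"
    "\<And>x a b. x \<in> WB \<Longrightarrow> a < DIM('b) \<Longrightarrow> b < DIM('b) \<Longrightarrow>
      metr B i x (E a x) (E b x) = (if a = b then 1 else 0)"
    using E unfolding orthonormal_frame_def by metis
  have e_diff: "e a differentiable (at z)" if "a < DIM('b \<times> 'd)" for a
    using W(3)[OF that] W(2) unfolding smooth_on_def by (metis Ck_on.simps(2))
  have E_diff: "E a differentiable (at (cmap B i p))" if "a < DIM('b)" for a
    using WB(2)[OF that] WB(1) unfolding smooth_on_def by (metis Ck_on.simps(2))
  have sff: "second_ff M T \<phi> (i, j) k (e a) (e b) z = hh (e a z) (e b z)" if "b < DIM('b \<times> 'd)" for a b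
    unfolding hh_def \<Gamma>_def \<Delta>_def c_def
    by (rule second_ff_eq[OF U z cC2[unfolded c_def] e_diff[OF that]])
  have cz: "cmap T k (\<phi> (p, q)) = c z"
  proof -
    have "param M (i, j) z = (p, q)"
      using param_M[of z] U_chart[OF z] p q B_chart(3) F_chart(3) by (simp add: z_def mem_Times_iff param_def)
    then show ?thesis by (simp add: c_def coord_rep_def)
  qed
  define S where "S = (\<Sum>a<DIM('b \<times> 'd). h (e a z) (e a z))"
  define Q where "Q = (\<Sum>a<DIM('b \<times> 'd). \<Sum>b<DIM('b \<times> 'd). h (e a z) (e b z) \<bullet> h (e a z) (e b z))"
  have n: "n = DIM('b \<times> 'd)" using assms by simp
  have n2: "2 \<le> n"
    using assms(3-5) DIM_positive[where 'a = 'b] DIM_positive[where 'a = 'd] by linarith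
  have mc: "mean_curvature_sq M T \<phi> (i, j) k e (p, q) = (S \<bullet> S) / (real n)\<^sup>2"
  proof -
    have "dir (mean_curvature_vector M T \<phi> (i, j) k e (p, q)) \<tau> (c z) = (1 / real n) *\<^sub>R S"
      unfolding mean_curvature_vector_def S_def h_def zM n
      by (simp add: dir_scaleR[OF \<tau>1] linear_sum[OF linear_dir[OF \<tau>1]] sff)
    then show ?thesis
      unfolding mean_curvature_sq_def metr_torus cz by (simp add: power2_eq_square)
  qed
  have ns: "second_ff_norm_sq M T \<phi> (i, j) k e (p, q) = Q"
    unfolding second_ff_norm_sq_def metr_torus cz zM Q_def h_def by (simp add: sff)

  \<comment> \<open>The estimate for one vector of the base frame\<close>
  have fp: "f p = \<rho> (fst z)" "\<rho> (fst z) > 0"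
    using p p_top assms(7) B_chart(3) by (simp_all add: \<rho>_def fst_z param_def)
  \<comment> \<open>A fibre basis vector rescaled to unit length in the warped metric; it exists
    because the fibre has positive dimension.\<close>
  obtain v where v: "(\<rho> (fst z))\<^sup>2 * metr F j (snd z) v v = 1"
  proof -
    obtain b :: 'd where b: "b \<in> Basis" using nonempty_Basis by blast
    define g where "g = metr F j (snd z) b b"
    have g: "0 < g"
      unfolding g_def using metr_F_pos[OF U_chart(2)[OF z] nonzero_Basis[OF b]] .
    have bil: "bilinear (metr F j (snd z))" using metr_F_bilinear[OF U_chart(2)[OF z]] .
    define t where "t = 1 / (\<rho> (fst z) * sqrt g)"
    have "(\<rho> (fst z))\<^sup>2 * metr F j (snd z) (t *\<^sub>R b) (t *\<^sub>R b) = (\<rho> (fst z) * sqrt g)\<^sup>2 * t\<^sup>2"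
      using g by (simp add: bilinear_lmul[OF bil] bilinear_rmul[OF bil] g_def[symmetric] power_mult_distrib power2_eq_square)
    also have "\<dots> = 1" using g fp(2) by (simp add: t_def power_divide)
    finally show ?thesis by (rule that)
  qed
  have bound: "(S \<bullet> S) / (2 * (real n - 1)) - Q / 2
      \<le> (dir (fst (\<Gamma> (E a (fst z), 0) (E a (fst z), 0))) \<rho> (fst z)
          - dir (E a (fst z)) (dir (E a (fst z)) \<rho>) (fst z)) / f p" if a: "a < DIM('b)" for a
  proof -
    define u where "u = E a (fst z)"
    have uu: "metr B i (fst z) u u = 1" using WB(3)[OF WB(1) a a] by (simp add: u_def fst_z)
    have 1: "dir (u, 0) \<psi> z \<bullet> dir (u, 0) \<psi> z = 1" "dir (0, v) \<psi> z \<bullet> dir (0, v) \<psi> z = 1"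
      "dir (u, 0) \<psi> z \<bullet> dir (0, v) \<psi> z = 0"
      using uu v by (simp_all add: iso[OF z, symmetric] metr_M bilinear_lzero[OF metr_F_bilinear[OF U_chart(2)[OF z]]]
          bilinear_lzero[OF metr_B_bilinear[OF U_chart(1)[OF z]]] bilinear_rzero[OF metr_B_bilinear[OF U_chart(1)[OF z]]])
    have "(S \<bullet> S) / (2 * (real n - 1)) - Q / 2 \<le> h (u, 0) (u, 0) \<bullet> h (0, v) (0, v) - h (u, 0) (0, v) \<bullet> h (u, 0) (0, v)"
      unfolding S_def Q_def n
      by (rule chen_inequality_frame[OF h_bilinear h_sym linear_dir _ 1])
         (use W Ck_on_2D(1)[OF \<psi>C2 z] in \<open>simp_all add: iso[OF z, symmetric]\<close>)
    also have "\<dots> \<le> H (u, 0) (u, 0) \<bullet> H (0, v) (0, v) - H (u, 0) (0, v) \<bullet> H (u, 0) (0, v)"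
      by (rule gauss)
    also have "\<dots> = \<rho> (fst z) * metr F j (snd z) v v *
        (dir (fst (\<Gamma> (u, 0) (u, 0))) \<rho> (fst z) - dir u (dir u \<rho>) (fst z))"
      unfolding H_def
    proof (rule warped_gauss[OF U z \<psi>C, where gB = "metr B i" and gF = "metr F j" and \<rho> = \<rho>])
      fix y u u' v v' assume y: "y \<in> U"
      show "dir (u, 0) \<psi> y \<bullet> dir (u', 0) \<psi> y = metr B i (fst y) u u'"
        "dir (u, 0) \<psi> y \<bullet> dir (0, v) \<psi> y = 0"
        "dir (0, v) \<psi> y \<bullet> dir (0, v') \<psi> y = (\<rho> (fst y))\<^sup>2 * metr F j (snd y) v v'"
        using U_chart[OF y] by (simp_all add: iso[OF y, symmetric] metr_M bilinear_lzero[OF metr_F_bilinear]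
          bilinear_lzero[OF metr_B_bilinear] bilinear_rzero[OF metr_B_bilinear])
    qed (use U_chart fp \<Gamma>(3) in \<open>auto intro: metr_B_differentiable metr_F_differentiable
        \<rho>_differentiable dir_\<rho>_differentiable\<close>)
    \<comment> \<open>The normalisation of \<open>v\<close> turns the factor in the Gauss equation
      into the reciprocal of \<open>f\<close>.\<close>
    also have "\<rho> (fst z) * metr F j (snd z) v v = 1 / f p"
      using v fp by (simp add: power2_eq_square field_simps)
    finally show ?thesis by (simp add: u_def)
  qed

  \<comment> \<open>Summation over the base frame\<close>
  have "real n1 * ((S \<bullet> S) / (2 * (real n - 1)) - Q / 2) = (\<Sum>a<DIM('b). (S \<bullet> S) / (2 * (real n - 1)) - Q / 2)"
    by (simp add: assms(3))
  also have "\<dots> \<le> (\<Sum>a<DIM('b). (dir (fst (\<Gamma> (E a (fst z), 0) (E a (fst z), 0))) \<rho> (fst z)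
          - dir (E a (fst z)) (dir (E a (fst z)) \<rho>) (fst z)) / f p)"
    by (rule sum_mono) (use bound in auto)
  also have "\<dots> = warped_laplacian B f F (i, j) E (p, q) / f p"
  proof -
    have "warped_laplacian B f F (i, j) E (p, q) = (\<Sum>a<DIM('b).
        dir (fst (\<Gamma> (E a (fst z), 0) (E a (fst z), 0))) \<rho> (fst z)
        - dir (E a (fst z)) (dir (E a (fst z)) \<rho>) (fst z))"
      unfolding \<Gamma>_def fst_z unfolding z_def by (rule warped_laplacian_eq[OF p q]) (rule E_diff)
    then show ?thesis by (simp only: sum_divide_distrib)
  qed
  finally show "warped_laplacian B f F (i, j) E (p, q) / f p \<ge>
               real n1 * (real n)\<^sup>2 / (2 * (real n - 1)) * mean_curvature_sq M T \<phi> (i, j) k e (p, q)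
               - real n1 / 2 * second_ff_norm_sq M T \<phi> (i, j) k e (p, q)"
    using n2 by (simp add: mc ns right_diff_distrib)
qed

end
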